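(* Let $0<\beta\le 1$ and $\lambda>0$, and let $W_\beta^f(t)=N_\beta(E_f(t))$, $t\ge 0$, where $\{N_\beta(t)\}_{t\ge0}$ is the fractional Poisson process with parameters $\beta,\lambda$ and $\{E_f(t)\}_{t\ge0}$ is the inverse of a subordinator $\{D_f(t)\}_{t\ge0}$, independent of $\{N_\beta(t)\}_{t\ge0}$. Then, for $n=0,1,2,\dots$, $$\mathbb{P}[W_{\beta}^{f}(t)=n]=\frac{\lambda^n}{n!}\sum_{k=0}^{\infty}\frac{(n+k)!}{k!}\frac{(-\lambda)^k}{\Gamma(\beta(k+n)+1)}\,\mathbb{E}\big[(E_{f}(t))^{\beta(n+k)}\big].$$
   Context: Subordinator and its inverse: $\{D_f(t)\}_{t\ge 0}$ is a nondecreasing Lévy process with $D_f(0)=0$ a.s. and $\mathbb{E}[e^{-sD_f(t)}]=e^{-tf(s)}$, $s>0$, where $f$ is the Bernstein function $f(s)=bs+\int_0^\infty(1-e^{-sx})\,\nu(dx)$, with $b\ge0$ and $\nu$ a non-negative Lévy measure on $(0,\infty)$ satisfying $\int_0^\infty (x\wedge1)\,\nu(dx)<\infty$ and $\nu(0,\infty)=\infty$ (so sample paths are a.s. strictly increasing). The inverse subordinator is $E_f(t)=\inf\{r\ge0:D_f(r)>t\}$, $t\ge0$; all its positive moments are finite. Fractional Poisson process (FPP): for $0<\beta<1$, let $\{D_\beta(t)\}$ be the $\beta$-stable subordinator, $\mathbb{E}[e^{-sD_\beta(t)}]=e^{-ts^\beta}$, and $E_\beta(t)=\inf\{r\ge0: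 D_\beta(r)>t\}$ the inverse $\beta$-stable subordinator. The FPP is $N_\beta(t)=N_\beta(t,\lambda)=N(E_\beta(t),\lambda)$, where $\{N(t,\lambda)\}$ is a Poisson process of rate $\lambda>0$ independent of $E_\beta$. For $\beta=1$ the FPP is the Poisson process of rate $\lambda$. *)

theory Defs
  imports "HOL-Probability.Probability"
begin

text \<open>
  Stochastic processes are families \<open>X :: real \<Rightarrow> 'a \<Rightarrow> _\<close> of which only the times
  \<open>t \<ge> 0\<close> matter; \<open>M\<close> is always the underlying probability space.
\<close>

definition cadlag :: "(real \<Rightarrow> real) \<Rightarrow> bool" where
  "cadlag x \<longleftrightarrow>
     (\<forall>t\<ge>0. (x \<longlongrightarrow> x t) (at_right t)) \<and> (\<forall>t>0. \<exists>l. (x \<longlongrightarrow> l) (at_left t))"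

definition levy_process :: "'a measure \<Rightarrow> (real \<Rightarrow> 'a \<Rightarrow> real) \<Rightarrow> bool" where
  "levy_process M X \<longleftrightarrow>
     (\<forall>t\<ge>0. X t \<in> borel_measurable M) \<and>
     (AE \<omega> in M. X 0 \<omega> = 0) \<and>
     (\<forall>(n::nat) (t::nat \<Rightarrow> real). 0 \<le> t 0 \<longrightarrow> mono t \<longrightarrow>
        prob_space.indep_vars M (\<lambda>_. borel) (\<lambda>i \<omega>. X (t (Suc i)) \<omega> - X (t i) \<omega>) {..<n}) \<and>
     (\<forall>s\<ge>0. \<forall>h\<ge>0. distr M borel (\<lambda>\<omega>. X (s + h) \<omega> - X s \<omega>) = distr M borel (X h)) \<and>
     (\<forall>t\<ge>0. \<forall>\<epsilon>>0.
        ((\<lambda>s. measure M {\<omega> \<in> space M. \<bar>X s \<omega> - X t \<omega>\<bar> > \<epsilon>}) \<longlongrightarrow> 0) (at t within {0..})) \<and>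
     (AE \<omega> in M. cadlag (\<lambda>t. X t \<omega>))"

definition indep_processes ::
    "'a measure \<Rightarrow> (real \<Rightarrow> 'a \<Rightarrow> real) \<Rightarrow> (real \<Rightarrow> 'a \<Rightarrow> real) \<Rightarrow> bool" where
  "indep_processes M X Y \<longleftrightarrow>
     prob_space.indep_var M
       (PiM {0..} (\<lambda>_. borel)) (\<lambda>\<omega>. \<lambda>t\<in>{0..}. X t \<omega>)
       (PiM {0..} (\<lambda>_. borel)) (\<lambda>\<omega>. \<lambda>t\<in>{0..}. Y t \<omega>)"

definition levy_measure :: "real measure \<Rightarrow> bool" where
  "levy_measure \<nu> \<longleftrightarrow>
     sets \<nu> = sets (restrict_space borel {0<..}) \<and>
     (\<integral>\<^sup>+x. ennreal (min x 1) \<partial>\<nu>) < \<infinity>"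

definition bernstein :: "real \<Rightarrow> real measure \<Rightarrow> real \<Rightarrow> real" where
  "bernstein b \<nu> s = b * s + (\<integral>x. 1 - exp (- s * x) \<partial>\<nu>)"

definition subordinator :: "'a measure \<Rightarrow> (real \<Rightarrow> real) \<Rightarrow> (real \<Rightarrow> 'a \<Rightarrow> real) \<Rightarrow> bool" where
  "subordinator M f D \<longleftrightarrow>
     levy_process M D \<and>
     (AE \<omega> in M. mono_on {0..} (\<lambda>t. D t \<omega>)) \<and>
     (\<forall>t\<ge>0. \<forall>s>0. (\<integral>\<omega>. exp (- s * D t \<omega>) \<partial>M) = exp (- t * f s))"

text \<open>
  The infimum is over a nonempty set for almost every \<open>\<omega>\<close>, since a subordinator with unbounded
  Laplace exponent tends to infinity almost surely.
\<close>

definition inverse_subordinator :: "(real \<Rightarrow> 'a \<Rightarrow> real) \<Rightarrow> real \<Rightarrow> 'a \<Rightarrow> real" where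
  "inverse_subordinator D t \<omega> = Inf {r. 0 \<le> r \<and> D r \<omega> > t}"

definition poisson_process :: "'a measure \<Rightarrow> real \<Rightarrow> (real \<Rightarrow> 'a \<Rightarrow> nat) \<Rightarrow> bool" where
  "poisson_process M lam N \<longleftrightarrow>
     levy_process M (\<lambda>t \<omega>. real (N t \<omega>)) \<and>
     (\<forall>t>0. N t \<in> measurable M (count_space UNIV) \<and>
        distr M (count_space UNIV) (N t) = measure_pmf (poisson_pmf (lam * t)))"

definition fractional_poisson_process ::
    "'a measure \<Rightarrow> real \<Rightarrow> real \<Rightarrow> (real \<Rightarrow> 'a \<Rightarrow> nat) \<Rightarrow> bool" where
  "fractional_poisson_process M \<beta> lam N\<beta> \<longleftrightarrow>
     (if \<beta> = 1 then poisson_process M lam N\<beta>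
      else \<exists>N D. poisson_process M lam N \<and>
             subordinator M (\<lambda>s. s powr \<beta>) D \<and>
             indep_processes M (\<lambda>t \<omega>. real (N t \<omega>)) (inverse_subordinator D) \<and>
             (\<forall>t\<ge>0. \<forall>\<omega>\<in>space M. N\<beta> t \<omega> = N (inverse_subordinator D t \<omega>) \<omega>))"

text \<open>
  Paths are regular only almost surely and \<open>M\<close> need not be complete, so measurability of the
  following composition is not automatic; whoever speaks of its law has to assume it.
\<close>

definition time_changed_fpp ::
    "(real \<Rightarrow> 'a \<Rightarrow> nat) \<Rightarrow> (real \<Rightarrow> 'a \<Rightarrow> real) \<Rightarrow> real \<Rightarrow> 'a \<Rightarrow> nat" where
  "time_changed_fpp N\<beta> D t \<omega> = N\<beta> (inverse_subordinator D t \<omega>) \<omega>"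

text \<open>
  The power \<open>x\<^sup>a\<close> for \<open>x \<ge> 0\<close> and \<open>a \<ge> 0\<close> with \<open>0\<^sup>0 = 1\<close>. The library has \<open>0 powr 0 = 0\<close>,
  which would give the wrong zeroth moment at \<open>t = 0\<close>, where the inverse subordinator vanishes
  almost surely.
\<close>

definition real_power :: "real \<Rightarrow> real \<Rightarrow> real" where
  "real_power x a = (if a = 0 then 1 else x powr a)"

end

(*
  The law of the process at the independent random time X = E_f(t) is the mixture E[p_n(X)], where
  p_n(r) = P(N_beta(r) = n); since only right continuity of paths is available, X is approximated by
  a grid from the right and the grid version is an instance of Fubini's theorem.

  The same mixture formula, applied to the Poisson process and the inverse stable subordinator, gives
  p_n(r) as a power series in r^beta once E[E_beta(r)^m] = m! r^(beta m) / Gamma(beta m + 1) is known.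
  For the latter, uniqueness of Laplace transforms yields the self-similarity D_beta(x) ~ x^(1/beta)
  D_beta(1), hence E_beta(r) ~ (r / D_beta(1))^beta, and the negative moments of D_beta(1) are Mellin
  transforms of its Laplace transform exp(-s^beta).

  Sum and expectation are interchanged because E_f(t) has all exponential moments: the Chernoff bound
  P(E_f(t) > x) <= P(D_f(x) <= t) <= exp(s t - x f(s)) has arbitrarily fast exponential decay, as f is
  unbounded, and x^p <= Gamma(p + 1) exp(x) makes up for the Gamma function in the coefficients.
*)
theory Submission
  imports Defs
begin

section \<open>Laplace transforms determine laws on the half-line\<close>

text \<open>The exponential series of \<open>exp (\<i> * s * U)\<close> is integrated term by term;
  since \<open>U\<close> is bounded by 1, the expected norms are dominated by the exponential series
  at \<open>\<bar>s\<bar>\<close>. Hence the characteristic function depends on the moments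
  alone.\<close>

lemma (in prob_space) char_distr_sums_moments:
  assumes [measurable]: "U \<in> borel_measurable M" and U: "AE \<omega> in M. \<bar>U \<omega>\<bar> \<le> 1"
  shows "(\<lambda>k. (\<i> * complex_of_real s) ^ k /\<^sub>R fact k * complex_of_real (expectation (\<lambda>\<omega>. U \<omega> ^ k)))
    sums char (distr M borel U) s"
proof -
  let ?f = "\<lambda>k \<omega>. (\<i> * complex_of_real (s * U \<omega>)) ^ k /\<^sub>R fact k"
  have norm: "norm (?f k \<omega>) = \<bar>s\<bar> ^ k /\<^sub>R fact k * \<bar>U \<omega>\<bar> ^ k" for k \<omega>
    by (simp add: norm_mult norm_power power_mult_distrib abs_mult)
  have pw: "AE \<omega> in M. \<bar>U \<omega>\<bar> ^ k \<le> 1" for k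
    using U by eventually_elim (simp add: power_le_one)
  have int: "integrable M (\<lambda>\<omega>. U \<omega> ^ k)" for k
    by (rule integrable_const_bound[where B = 1]) (use pw in \<open>auto simp: power_abs\<close>)
  have int': "integrable M (\<lambda>\<omega>. \<bar>U \<omega>\<bar> ^ k)" for k
    using integrable_abs[OF int[of k]] by (simp add: power_abs)
  have f: "?f k = (\<lambda>\<omega>. (\<i> * complex_of_real s) ^ k /\<^sub>R fact k * complex_of_real (U \<omega> ^ k))" for k
    by (auto simp: power_mult_distrib fun_eq_iff)
  have "integrable M (?f k)" for k
    unfolding f using int by (intro integrable_mult_right integrable_of_real)
  moreover have "AE \<omega> in M. summable (\<lambda>k. norm (?f k \<omega>))"
    using summable_norm_exp by (intro AE_I2)
  moreover have "summable (\<lambda>k. \<integral>\<omega>. norm (?f k \<omega>) \<partial>M)"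
  proof (rule summable_comparison_test'[OF summable_exp_generic[of "\<bar>s\<bar>"]])
    fix k
    have "expectation (\<lambda>\<omega>. \<bar>U \<omega>\<bar> ^ k) \<le> 1"
      using integral_mono_AE[OF int' _ pw, of k] by (simp add: prob_space)
    then show "norm (\<integral>\<omega>. norm (?f k \<omega>) \<partial>M) \<le> \<bar>s\<bar> ^ k /\<^sub>R fact k"
      unfolding norm by (simp add: mult_left_le divide_right_mono)
  qed
  ultimately have "(\<lambda>k. \<integral>\<omega>. ?f k \<omega> \<partial>M) sums (\<integral>\<omega>. (\<Sum>k. ?f k \<omega>) \<partial>M)"
    by (rule sums_integral)
  moreover have "(\<integral>\<omega>. ?f k \<omega> \<partial>M) =
      (\<i> * complex_of_real s) ^ k /\<^sub>R fact k * complex_of_real (expectation (\<lambda>\<omega>. U \<omega> ^ k))" for k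
    unfolding f using int[of k] by (simp del: of_real_power)
  moreover have "(\<integral>\<omega>. (\<Sum>k. ?f k \<omega>) \<partial>M) = char (distr M borel U) s"
    by (simp add: char_def integral_distr exp_def)
  ultimately show ?thesis
    by simp
qed

lemma (in prob_space) distr_eq_of_moments:
  fixes U V :: "'a \<Rightarrow> real"
  assumes [measurable]: "U \<in> borel_measurable M" "V \<in> borel_measurable M"
    and "AE \<omega> in M. \<bar>U \<omega>\<bar> \<le> 1" "AE \<omega> in M. \<bar>V \<omega>\<bar> \<le> 1"
    and eq: "\<And>k. expectation (\<lambda>\<omega>. U \<omega> ^ k) = expectation (\<lambda>\<omega>. V \<omega> ^ k)"
  shows "distr M borel U = distr M borel V"
proof (rule Levy_uniqueness)
  show "char (distr M borel U) = char (distr M borel V)"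
  proof
    fix s
    show "char (distr M borel U) s = char (distr M borel V) s"
      using char_distr_sums_moments[of U s] char_distr_sums_moments[of V s] assms(1-4)
      unfolding eq by (blast intro: sums_unique2)
  qed
qed auto

text \<open>The variable \<open>exp (- X)\<close> takes values in the unit interval, and its k-th
  moment is the Laplace transform of \<open>X\<close> at k. The problem is thus reduced to the
  moments of bounded variables.\<close>

lemma (in prob_space) distr_eq_of_laplace:
  fixes X Y :: "'a \<Rightarrow> real"
  assumes [measurable]: "X \<in> borel_measurable M" "Y \<in> borel_measurable M"
    and X: "AE \<omega> in M. 0 \<le> X \<omega>" and Y: "AE \<omega> in M. 0 \<le> Y \<omega>"
    and eq: "\<And>s. 0 < s \<Longrightarrow> expectation (\<lambda>\<omega>. exp (- s * X \<omega>)) = expectation (\<lambda>\<omega>. exp (- s * Y \<omega>))"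
  shows "distr M borel X = distr M borel Y"
proof -
  have "distr M borel (\<lambda>\<omega>. exp (- X \<omega>)) = distr M borel (\<lambda>\<omega>. exp (- Y \<omega>))"
  proof (rule distr_eq_of_moments)
    show "expectation (\<lambda>\<omega>. exp (- X \<omega>) ^ k) = expectation (\<lambda>\<omega>. exp (- Y \<omega>) ^ k)" for k
      using eq[of "real k"] by (cases "k = 0") (auto simp: exp_of_nat_mult[symmetric])
  qed (use X Y in \<open>auto elim!: eventually_mono\<close>)
  \<comment> \<open>Since \<open>- ln (exp (- x)) = x\<close> for every real \<open>x\<close>,
    pushing forward along \<open>- ln u\<close> recovers the original laws.\<close>
  then have "distr (distr M borel (\<lambda>\<omega>. exp (- X \<omega>))) borel (\<lambda>u. - ln u) =
      distr (distr M borel (\<lambda>\<omega>. exp (- Y \<omega>))) borel (\<lambda>u. - ln u)"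
    by simp
  then show ?thesis
    by (simp add: distr_distr comp_def)
qed

section \<open>Subordinators and their inverses\<close>

text \<open>Together with \<open>le_inverse_subordinator\<close> this squeezes the event
  \<open>D x \<omega> \<le> t\<close> between a strict and a nonstrict comparison of
  \<open>x\<close> with the inverse. Neither is an equivalence in general: \<open>D\<close> may jump
  across the level \<open>t\<close> at time \<open>x\<close>, or reach \<open>t\<close> exactly
  there.\<close>

lemma inverse_subordinator_less_imp:
  assumes "0 \<le> x" "x < inverse_subordinator D t \<omega>"
  shows "D x \<omega> \<le> t"
proof (rule ccontr)
  assume "\<not> D x \<omega> \<le> t"
  then have "inverse_subordinator D t \<omega> \<le> x"
    unfolding inverse_subordinator_def using assms by (intro cInf_lower bdd_belowI[of _ 0]) auto
  with assms show False by simp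
qed

text \<open>By monotonicity every time at which the path exceeds \<open>t\<close> lies after
  \<open>x\<close>. The second assumption excludes the infimum of the empty set, which is an
  uninformative default value.\<close>

lemma le_inverse_subordinator:
  assumes "mono_on {0..} (\<lambda>t. D t \<omega>)" and unb: "\<exists>r\<ge>0. t < D r \<omega>"
    and "0 \<le> x" "D x \<omega> \<le> t"
  shows "x \<le> inverse_subordinator D t \<omega>"
  unfolding inverse_subordinator_def
proof (rule cInf_greatest)
  show "x \<le> r" if "r \<in> {r. 0 \<le> r \<and> t < D r \<omega>}" for r
    using that assms mono_onD[OF assms(1), of r x] by (cases "r \<le> x") auto
qed (use unb in auto)

lemma inverse_subordinator_nonneg:
  assumes "\<exists>r\<ge>0. t < D r \<omega>"
  shows "0 \<le> inverse_subordinator D t \<omega>"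
  unfolding inverse_subordinator_def using assms by (intro cInf_greatest) auto

lemma inverse_subordinator_mono:
  assumes "s \<le> t" "\<exists>r\<ge>0. t < D r \<omega>"
  shows "inverse_subordinator D s \<omega> \<le> inverse_subordinator D t \<omega>"
  unfolding inverse_subordinator_def using assms
  by (intro cInf_superset_mono bdd_belowI[of _ 0]) auto

text \<open>A time \<open>r\<close> slightly above the infimum with \<open>D r \<omega> > t\<close>
  still satisfies \<open>D r \<omega> > s\<close> for \<open>s\<close> close to \<open>t\<close> on
  the right, so it bounds the inverse at \<open>s\<close> as well.\<close>

lemma inverse_subordinator_right_continuous:
  assumes unb: "\<And>T. \<exists>r\<ge>0. T < D r \<omega>"
  shows "((\<lambda>s. inverse_subordinator D s \<omega>) \<longlongrightarrow> inverse_subordinator D t \<omega>) (at_right t)"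
proof (rule tendstoI)
  fix e :: real assume "0 < e"
  let ?E = "\<lambda>s. inverse_subordinator D s \<omega>"
  have "\<exists>r\<in>{r. 0 \<le> r \<and> t < D r \<omega>}. r < ?E t + e"
    unfolding inverse_subordinator_def using unb[of t] \<open>0 < e\<close>
    by (intro cInf_lessD) auto
  then obtain r where r: "0 \<le> r" "t < D r \<omega>" "r < ?E t + e" by auto
  have "\<forall>\<^sub>F s in at_right t. t < s \<and> s < D r \<omega>"
    using r(2) unfolding eventually_at_right_field by auto
  then show "\<forall>\<^sub>F s in at_right t. dist (?E s) (?E t) < e"
  proof eventually_elim
    case (elim s)
    then have "?E s \<le> r"
      unfolding inverse_subordinator_def using r by (intro cInf_lower bdd_belowI[of _ 0]) auto
    moreover have "?E t \<le> ?E s"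
      using elim unb by (intro inverse_subordinator_mono) auto
    ultimately show ?case using r by (simp add: dist_real_def)
  qed
qed

section \<open>Almost sure behaviour of subordinators and exponential moments of their
  inverses\<close>

context prob_space
begin

lemma subordinator_measurable:
  assumes "subordinator M f D" "0 \<le> x"
  shows "D x \<in> borel_measurable M"
  using assms by (auto simp: subordinator_def levy_process_def)

lemma subordinator_nonneg:
  assumes "subordinator M f D"
  shows "AE \<omega> in M. \<forall>x\<ge>0. 0 \<le> D x \<omega>"
proof -
  have "AE \<omega> in M. D 0 \<omega> = 0" "AE \<omega> in M. mono_on {0..} (\<lambda>t. D t \<omega>)"
    using assms by (auto simp: subordinator_def levy_process_def)
  then show ?thesis
    by eventually_elim (metis atLeast_iff mono_onD order_refl)
qed

lemma integrable_exp_neg: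
  assumes [measurable]: "X \<in> borel_measurable M" and "AE \<omega> in M. (0::real) \<le> X \<omega>"
    and "0 \<le> s"
  shows "integrable M (\<lambda>\<omega>. exp (- s * X \<omega>))"
  by (rule integrable_const_bound[where B = 1]) (use assms in \<open>auto elim!: eventually_mono\<close>)

text \<open>Chernoff bound: the indicator of \<open>D x \<omega> \<le> t\<close> is at most
  \<open>exp (s * (t - D x \<omega>))\<close>, whose expectation is given by the Laplace
  exponent.\<close>

lemma subordinator_tail:
  assumes sub: "subordinator M f D" and "0 \<le> x" "0 < s"
  shows "prob {\<omega> \<in> space M. D x \<omega> \<le> t} \<le> exp (s * t - x * f s)"
proof -
  have [measurable]: "D x \<in> borel_measurable M"
    using subordinator_measurable assms by auto
  have int: "integrable M (\<lambda>\<omega>. exp (- s * D x \<omega>))"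
    using subordinator_nonneg[OF sub] assms by (intro integrable_exp_neg) auto
  have "prob {\<omega> \<in> space M. D x \<omega> \<le> t} = (\<integral>\<omega>. indicator {\<omega> \<in> space M. D x \<omega> \<le> t} \<omega> \<partial>M)"
    by simp
  also have "\<dots> \<le> (\<integral>\<omega>. exp (s * t) * exp (- s * D x \<omega>) \<partial>M)"
  proof (rule integral_mono)
    show "indicator {\<omega> \<in> space M. D x \<omega> \<le> t} \<omega> \<le> exp (s * t) * exp (- s * D x \<omega>)" for \<omega>
      using \<open>0 < s\<close> by (auto simp: indicator_def exp_add[symmetric])
  qed (use int in \<open>auto simp: integrable_indicator_iff emeasure_eq_measure\<close>)
  also have "\<dots> = exp (s * t) * exp (- x * f s)"
    using assms by (simp add: subordinator_def)
  finally show ?thesis by (simp add: exp_add[symmetric])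
qed

text \<open>For positive \<open>f s\<close> the tail bound along integer times tends to 0, so the
  paths that stay below a fixed level at all integer times form a null set. Countably many levels
  suffice.\<close>

lemma subordinator_unbounded:
  assumes sub: "subordinator M f D" and "0 < s" "0 < f s"
  shows "AE \<omega> in M. \<forall>T. \<exists>r\<ge>0. T < D r \<omega>"
proof -
  have [measurable]: "D (real k) \<in> borel_measurable M" for k
    using subordinator_measurable[OF sub] by auto
  have "AE \<omega> in M. \<exists>k. real n < D (real k) \<omega>" for n :: nat
  proof -
    let ?B = "{\<omega> \<in> space M. \<forall>k. D (real k) \<omega> \<le> real n}"
    have "prob ?B \<le> exp (s * real n - real k * f s)" for k
    proof -
      have "prob ?B \<le> prob {\<omega> \<in> space M. D (real k) \<omega> \<le> real n}"
        by (rule finite_measure_mono) auto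
      with subordinator_tail[OF sub, of "real k" s "real n"] \<open>0 < s\<close> show ?thesis by simp
    qed
    moreover have "(\<lambda>k. exp (s * real n - real k * f s)) \<longlonglongrightarrow> 0"
      using \<open>0 < f s\<close> by real_asymp
    ultimately have "prob ?B \<le> 0"
      by (intro LIMSEQ_le_const) auto
    then have "prob ?B = 0" by (simp add: measure_le_0_iff)
    then have "AE \<omega> in M. \<omega> \<notin> ?B"
      by (intro AE_iff_measurable[THEN iffD2, OF _ refl]) (auto simp: emeasure_eq_measure)
    with AE_space show ?thesis by eventually_elim (auto simp: not_le)
  qed
  then have "AE \<omega> in M. \<forall>n::nat. \<exists>k::nat. real n < D (real k) \<omega>"
    by (simp add: AE_all_countable)
  then show ?thesis
  proof eventually_elim
    case (elim \<omega>)
    show ?case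
    proof
      fix T
      obtain n :: nat where "T \<le> real n" using real_arch_simple by blast
      moreover obtain k :: nat where "real n < D (real k) \<omega>" using elim by blast
      ultimately show "\<exists>r\<ge>0. T < D r \<omega>" by (intro exI[of _ "real k"]) auto
    qed
  qed
qed

text \<open>The range of the inverse is cut into layers between consecutive integers. Where it
  exceeds \<open>j\<close>, one has \<open>D j \<omega> \<le> t\<close>, an event of probability at
  most \<open>exp (s * t - j * f s)\<close>; the weights \<open>?c j\<close> grow more slowly than
  this decays. The summand 1 accounts for the value 0, which lies in no layer.\<close>

lemma exp_moment_inverse_subordinator:
  assumes sub: "subordinator M f D" and "0 < s" "a + 1 \<le> f s" "0 \<le> a"
    and [measurable]: "inverse_subordinator D t \<in> borel_measurable M"
  shows "integrable M (\<lambda>\<omega>. exp (a * inverse_subordinator D t \<omega>))"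
proof -
  let ?E = "inverse_subordinator D t"
  let ?c = "\<lambda>j::nat. exp (a * (real j + 1))" and ?A = "\<lambda>j::nat. {\<omega> \<in> space M. D (real j) \<omega> \<le> t}"
  have [measurable]: "D (real k) \<in> borel_measurable M" for k
    using subordinator_measurable[OF sub] by auto
  have term_le: "g j \<le> (\<Sum>j. g j)" for g :: "nat \<Rightarrow> ennreal" and j
    using sum_le_suminf[of g "{j}"] by auto
  have "AE \<omega> in M. \<forall>T. \<exists>r\<ge>0. T < D r \<omega>"
    using subordinator_unbounded[OF sub \<open>0 < s\<close>] assms by auto
  with AE_space have "AE \<omega> in M. ennreal (exp (a * ?E \<omega>)) \<le>
      1 + (\<Sum>j. ennreal (?c j) * indicator (?A j) \<omega>)"
  proof eventually_elim
    case (elim \<omega>)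
    show ?case
    proof (cases "?E \<omega> = 0")
      case False
      with inverse_subordinator_nonneg[of t D \<omega>] elim have pos: "0 < ?E \<omega>" by force
      \<comment> \<open>The layers are open on the left: the strict inequality
        \<open>j < ?E \<omega>\<close> is what yields \<open>D j \<omega> \<le> t\<close>, hence the
        ceiling minus one instead of the floor.\<close>
      define j where "j = nat (\<lceil>?E \<omega>\<rceil> - 1)"
      have j: "real j < ?E \<omega>" "?E \<omega> \<le> real j + 1"
        using pos ceiling_correct[of "?E \<omega>"] unfolding j_def by (auto simp: of_nat_nat)
      then have "D (real j) \<omega> \<le> t"
        by (intro inverse_subordinator_less_imp[OF _ j(1)]) simp
      have "ennreal (exp (a * ?E \<omega>)) \<le> ennreal (?c j) * indicator (?A j) \<omega>"
        using elim(1) \<open>D (real j) \<omega> \<le> t\<close> mult_left_mono[OF j(2) \<open>0 \<le> a\<close>] by (simp add: ennreal_leI)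
      also have "\<dots> \<le> (\<Sum>j. ennreal (?c j) * indicator (?A j) \<omega>)"
        by (rule term_le)
      finally show ?thesis by (rule order_trans) simp
    qed simp
  qed
  then have "(\<integral>\<^sup>+\<omega>. ennreal (exp (a * ?E \<omega>)) \<partial>M) \<le>
      (\<integral>\<^sup>+\<omega>. 1 + (\<Sum>j. ennreal (?c j) * indicator (?A j) \<omega>) \<partial>M)"
    by (rule nn_integral_mono_AE)
  also have "\<dots> = 1 + (\<Sum>j. ennreal (?c j) * emeasure M (?A j))"
    by (subst nn_integral_add)
      (auto simp: nn_integral_suminf nn_integral_cmult emeasure_space_1 simp del: suminf_cmult_indicator)
  also have "\<dots> \<le> 1 + (\<Sum>j. ennreal (exp (a + s * t) * exp (- 1) ^ j))"
  proof (intro add_left_mono suminf_le allI)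
    fix j :: nat
    have "?c j * prob (?A j) \<le> ?c j * exp (s * t - real j * f s)"
      using subordinator_tail[OF sub, of "real j" s t] \<open>0 < s\<close> by simp
    also have "\<dots> = exp (a * (real j + 1) + s * t - real j * f s)"
      by (simp add: exp_add[symmetric] algebra_simps)
    \<comment> \<open>The surplus 1 in \<open>a + 1 \<le> f s\<close> leaves a factor
      \<open>exp (- 1)\<close> per layer, so a geometric series remains.\<close>
    also have "\<dots> \<le> exp (a + s * t - real j)"
      using mult_left_mono[OF assms(3), of "real j"] by (simp add: algebra_simps)
    also have "\<dots> = exp (a + s * t) * exp (- 1) ^ j"
      by (simp add: exp_of_nat_mult[symmetric] exp_add[symmetric])
    finally show "ennreal (?c j) * emeasure M (?A j) \<le> ennreal (exp (a + s * t) * exp (- 1) ^ j)"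
      by (simp add: emeasure_eq_measure ennreal_mult[symmetric] ennreal_leI)
  qed auto
  also have "\<dots> = ennreal (1 + (\<Sum>j. exp (a + s * t) * exp (- 1) ^ j))"
    using summable_mult[OF summable_geometric[of "exp (- 1 :: real)"], of "exp (a + s * t)"]
    by (subst suminf_ennreal2) (auto simp: suminf_nonneg)
  finally have "(\<integral>\<^sup>+\<omega>. ennreal (exp (a * ?E \<omega>)) \<partial>M) < \<infinity>"
    by (rule le_less_trans) simp
  then show ?thesis
    by (intro integrableI_bounded) auto
qed

end

text \<open>Along \<open>s = n + 1\<close> the integrands \<open>1 - exp (- s * x)\<close> increase
  to 1 on the half-line, so by monotone convergence their integrals tend to the total mass of
  \<open>\<nu>\<close>, which is infinite.\<close>

lemma bernstein_unbounded:
  assumes "0 \<le> b" and levy: "levy_measure \<nu>" and inf: "emeasure \<nu> {0<..} = \<infinity>"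
  shows "\<exists>s>0. C \<le> bernstein b \<nu> s"
proof -
  let ?f = "\<lambda>(n::nat) x::real. 1 - exp (- real (Suc n) * x)"
  have sets: "sets \<nu> = sets (restrict_space borel {0<..})" using levy by (simp add: levy_measure_def)
  then have space: "space \<nu> = {0<..}" using sets_eq_imp_space_eq[of \<nu>] by (simp add: space_restrict_space)
  have meas: "g \<in> borel_measurable \<nu>" if "g \<in> borel_measurable borel" for g :: "real \<Rightarrow> real"
    using measurable_restrict_space1[OF that, of "{0<..}"] sets by (metis measurable_cong_sets)
  have f: "?f n \<in> borel_measurable \<nu>" for n
    by (intro meas) measurable
  have "(\<lambda>n. \<integral>\<^sup>+x. ennreal (?f n x) \<partial>\<nu>) \<longlonglongrightarrow> (\<integral>\<^sup>+x. indicator {0<..} x \<partial>\<nu>)"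
  proof (rule nn_integral_LIMSEQ)
    show "incseq (\<lambda>n x. ennreal (?f n x))"
    proof (intro incseq_SucI le_funI)
      fix n and x :: real
      \<comment> \<open>Monotonicity is claimed for all reals; at negative \<open>x\<close> the
        integrand is nonpositive and \<open>ennreal\<close> truncates it to 0.\<close>
      show "ennreal (?f n x) \<le> ennreal (?f (Suc n) x)"
      proof (cases "0 \<le> x")
        case True
        then show ?thesis by (intro ennreal_leI) (auto simp: algebra_simps)
      next
        case False
        then have "?f n x \<le> 0" by (simp add: mult_nonpos_nonpos)
        then show ?thesis by (simp add: ennreal_neg)
      qed
    qed
    show "(\<lambda>n. ennreal (?f n x)) \<longlonglongrightarrow> indicator {0<..} x" for x
    proof (cases "0 < x")
      case True
      then have "(\<lambda>n. ?f n x) \<longlonglongrightarrow> 1" by real_asymp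
      then have "(\<lambda>n. ennreal (?f n x)) \<longlonglongrightarrow> ennreal 1" by (rule tendsto_ennrealI)
      with True show ?thesis by simp
    next
      case False
      then have "?f n x \<le> 0" for n by (simp add: mult_nonpos_nonpos)
      with False show ?thesis by (simp add: ennreal_neg)
    qed
  qed (rule measurable_compose[OF f measurable_ennreal])
  also have "(\<integral>\<^sup>+x. indicator {0<..} x \<partial>\<nu>) = \<infinity>"
    using inf sets.top[of \<nu>] unfolding space by simp
  finally have "\<forall>\<^sub>F n in sequentially. ennreal C < (\<integral>\<^sup>+x. ennreal (?f n x) \<partial>\<nu>)"
    by (rule order_tendstoD) simp
  then obtain n where n: "ennreal C < (\<integral>\<^sup>+x. ennreal (?f n x) \<partial>\<nu>)"
    by (auto simp: eventually_sequentially)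
  \<comment> \<open>The Bochner integral in \<open>bernstein\<close> defaults to 0 for a
    nonintegrable function, so integrability must be secured before passing to it. The dominating
    function is a multiple of the one in the Levy condition.\<close>
  have bound: "?f n x \<le> (real n + 1) * min x 1" if "0 < x" for x
  proof (cases "x \<le> 1")
    case True
    then show ?thesis using exp_ge_add_one_self[of "- real (Suc n) * x"] by (simp add: algebra_simps)
  qed (simp add: add_increasing)
  have nonneg: "0 \<le> ?f n x" if "0 < x" for x
    using that by (simp add: mult_nonpos_nonneg)
  have "integrable \<nu> (\<lambda>x. min x 1)"
    using levy by (intro integrableI_nonneg meas AE_I2) (auto simp: levy_measure_def space)
  then have "integrable \<nu> (\<lambda>x. (real n + 1) * min x 1)"
    by (rule integrable_mult_right)
  then have "integrable \<nu> (?f n)"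
  proof (rule Bochner_Integration.integrable_bound[OF _ f AE_I2])
    fix x assume "x \<in> space \<nu>"
    then have "0 < x" using space by simp
    with bound[of x] nonneg[of x] show "norm (?f n x) \<le> norm ((real n + 1) * min x 1)"
      unfolding real_norm_def by linarith
  qed
  then have "(\<integral>\<^sup>+x. ennreal (?f n x) \<partial>\<nu>) = ennreal (\<integral>x. ?f n x \<partial>\<nu>)"
    using nonneg by (intro nn_integral_eq_integral AE_I2) (auto simp: space)
  with n have "C \<le> (\<integral>x. ?f n x \<partial>\<nu>)"
    by (metis ennreal_leI leD linorder_le_cases)
  also have "\<dots> \<le> bernstein b \<nu> (real (Suc n))"
    using \<open>0 \<le> b\<close> by (simp add: bernstein_def)
  finally show ?thesis by (intro exI[of _ "real (Suc n)"]) simp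
qed

section \<open>Moments of inverse stable subordinators\<close>

lemma powr_le_powr_iff:
  fixes a x y :: real assumes "0 < a" "0 \<le> x" "0 \<le> y"
  shows "x powr a \<le> y powr a \<longleftrightarrow> x \<le> y"
  using assms by (metis less_imp_le not_le powr_less_mono2 powr_mono2)

text \<open>This is Euler's integral for \<open>Gamma p\<close> after the substitution
  \<open>t = y * s\<close>.\<close>

lemma nn_integral_powr_exp:
  fixes p y :: real assumes "0 < p" "0 < y"
  shows "(\<integral>\<^sup>+s. ennreal (indicator {0..} s * s powr (p - 1) * exp (- s * y)) \<partial>lborel) =
    ennreal (Gamma p * y powr (- p))"
proof -
  let ?I = "\<integral>\<^sup>+s. ennreal (indicator {0..} s * s powr (p - 1) * exp (- s * y)) \<partial>lborel"
  have "ennreal (Gamma p) = (\<integral>\<^sup>+t. ennreal (indicator {0..} t * t powr (p - 1) / exp t) \<partial>lborel)"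
    using Gamma_conv_nn_integral_real[OF \<open>0 < p\<close>] .
  also have "\<dots> = ennreal \<bar>y\<bar> * (\<integral>\<^sup>+s. ennreal (indicator {0..} (0 + y * s) * (0 + y * s) powr (p - 1) / exp (0 + y * s)) \<partial>lborel)"
    using \<open>0 < y\<close> by (intro nn_integral_real_affine) auto
  also have "\<dots> = ennreal \<bar>y\<bar> * (\<integral>\<^sup>+s. ennreal (y powr (p - 1)) * ennreal (indicator {0..} s * s powr (p - 1) * exp (- s * y)) \<partial>lborel)"
    using \<open>0 < y\<close> by (intro arg_cong2[where f = "(*)"] nn_integral_cong refl)
      (auto simp: ennreal_mult[symmetric] indicator_def powr_mult exp_minus field_simps zero_le_mult_iff)
  also have "\<dots> = ennreal (y powr p) * ?I"
    using \<open>0 < y\<close> by (subst nn_integral_cmult)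
      (auto simp: mult.assoc[symmetric] ennreal_mult[symmetric] powr_diff)
  finally have *: "ennreal (Gamma p) = ennreal (y powr p) * ?I" .
  have "ennreal (Gamma p * y powr (- p)) = ennreal (y powr (- p)) * (ennreal (y powr p) * ?I)"
    unfolding *[symmetric] using \<open>0 < p\<close> by (simp add: ennreal_mult[symmetric] mult.commute)
  also have "\<dots> = ?I"
    using \<open>0 < y\<close> by (simp add: mult.assoc[symmetric] ennreal_mult[symmetric] powr_add[symmetric])
  finally show ?thesis ..
qed

text \<open>The idea is to write \<open>exp (- c)\<close> as the integral of \<open>exp (- u)\<close> over \<open>u \<ge> c\<close>, which avoids substituting \<open>u = s powr \<beta>\<close>.\<close>

lemma nn_integral_powr_exp_neg_powr:
  fixes p \<beta> :: real assumes "0 < p" "0 < \<beta>"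
  shows "(\<integral>\<^sup>+s. ennreal (indicator {0..} s * s powr (p - 1) * exp (- (s powr \<beta>))) \<partial>lborel) =
    ennreal (Gamma (p / \<beta> + 1) / p)"
proof -
  have iff: "s powr \<beta> \<le> u \<longleftrightarrow> s \<le> u powr (1 / \<beta>)" if "0 \<le> s" "0 \<le> u" for s u
  proof -
    have "s \<le> u powr (1 / \<beta>) \<longleftrightarrow> s powr \<beta> \<le> (u powr (1 / \<beta>)) powr \<beta>"
      using that \<open>0 < \<beta>\<close> by (intro powr_le_powr_iff[symmetric]) auto
    then show ?thesis using that \<open>0 < \<beta>\<close> by (cases "u = 0") (auto simp: powr_powr)
  qed
  have exp: "ennreal (exp (- c)) = (\<integral>\<^sup>+u. ennreal (exp (- u)) * indicator {c..} u \<partial>lborel)" for c :: real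
    using nn_integral_has_integral_lebesgue'[OF _ has_integral_exp_minus_to_infinity[of 1 c]] by simp
  have pow: "(\<integral>\<^sup>+s. ennreal (s powr (p - 1)) * indicator {0..c} s \<partial>lborel) = ennreal (c powr p / p)"
    if "0 \<le> c" for c
    using nn_integral_has_integral_lebesgue'[OF _ has_integral_powr_from_0[of "p - 1" c]] that \<open>0 < p\<close> by simp
  let ?g = "\<lambda>s u. ennreal (indicator {0..} s * s powr (p - 1)) * (ennreal (exp (- u)) * indicator {s powr \<beta>..} u)"
  have "(\<integral>\<^sup>+s. ennreal (indicator {0..} s * s powr (p - 1) * exp (- (s powr \<beta>))) \<partial>lborel) =
      (\<integral>\<^sup>+s. \<integral>\<^sup>+u. ?g s u \<partial>lborel \<partial>lborel)"
  proof (rule nn_integral_cong)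
    fix s :: real
    show "ennreal (indicator {0..} s * s powr (p - 1) * exp (- (s powr \<beta>))) = (\<integral>\<^sup>+u. ?g s u \<partial>lborel)"
      by (subst nn_integral_cmult) (auto simp: exp[symmetric] ennreal_mult)
  qed
  \<comment> \<open>For fixed \<open>u \<ge> 0\<close> the region
    \<open>s powr \<beta> \<le> u\<close> is the interval from 0 to
    \<open>u powr (1 / \<beta>)\<close>. The inner integral over \<open>s\<close> then equals
    \<open>u powr (p / \<beta>) / p\<close>, up to the factor \<open>exp (- u)\<close>, and a Gamma
    integral is left.\<close>
  also have "\<dots> = (\<integral>\<^sup>+u. \<integral>\<^sup>+s. ?g s u \<partial>lborel \<partial>lborel)"
  proof (rule lborel_pair.Fubini')
    have "(\<lambda>(u, s). ?g s u) = (\<lambda>(u, s). ennreal (indicator {0..} s * s powr (p - 1)) *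
        (ennreal (exp (- u)) * indicator {x. snd x powr \<beta> \<le> fst x} (u, s)))"
      by (auto simp: fun_eq_iff indicator_def)
    also have "\<dots> \<in> borel_measurable (lborel \<Otimes>\<^sub>M lborel)"
      by measurable
    finally show "(\<lambda>(u, s). ?g s u) \<in> borel_measurable (lborel \<Otimes>\<^sub>M lborel)" .
  qed
  also have "\<dots> = (\<integral>\<^sup>+u. ennreal (1 / p) * ennreal (indicator {0..} u * u powr (p / \<beta> + 1 - 1) / exp u) \<partial>lborel)"
  proof (rule nn_integral_cong)
    fix u :: real
    show "(\<integral>\<^sup>+s. ?g s u \<partial>lborel) = ennreal (1 / p) * ennreal (indicator {0..} u * u powr (p / \<beta> + 1 - 1) / exp u)"
    proof (cases "0 \<le> u")
      case True
      have "(\<integral>\<^sup>+s. ?g s u \<partial>lborel) =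
          (\<integral>\<^sup>+s. ennreal (exp (- u)) * (ennreal (s powr (p - 1)) * indicator {0..u powr (1 / \<beta>)} s) \<partial>lborel)"
        using True by (intro nn_integral_cong) (auto simp: indicator_def iff mult.commute)
      also have "\<dots> = ennreal (exp (- u)) * ennreal ((u powr (1 / \<beta>)) powr p / p)"
        by (subst nn_integral_cmult) (auto simp: pow)
      finally show ?thesis
        using True \<open>0 < p\<close> by (simp add: ennreal_mult[symmetric] powr_powr exp_minus field_simps)
    next
      case False
      have "?g s u = 0" for s
        using False powr_ge_zero[of s \<beta>] by (auto simp: indicator_def simp del: powr_ge_zero)
      then have "(\<integral>\<^sup>+s. ?g s u \<partial>lborel) = (\<integral>\<^sup>+s. 0 \<partial>(lborel :: real measure))"
        by (intro nn_integral_cong)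
      with False show ?thesis by simp
    qed
  qed
  also have "\<dots> = ennreal (1 / p) * (\<integral>\<^sup>+u. ennreal (indicator {0..} u * u powr (p / \<beta> + 1 - 1) / exp u) \<partial>lborel)"
    by (rule nn_integral_cmult) measurable
  also have "\<dots> = ennreal (1 / p) * ennreal (Gamma (p / \<beta> + 1))"
    using assms by (subst Gamma_conv_nn_integral_real) (auto simp: add_pos_pos)
  finally show ?thesis using assms by (simp add: ennreal_mult'[symmetric])
qed

section \<open>Self-similarity of stable subordinators and the moments of their inverses\<close>

context prob_space
begin

text \<open>The hypotheses have the form in which the inverse of a subordinator is accessible, with
  a strict tail on one side and a nonstrict one on the other. They determine the law because the
  resulting gap between the distribution functions closes by right continuity.\<close>

lemma distr_eq_of_tail_squeeze:
  fixes X Z :: "'a \<Rightarrow> real"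
  assumes [measurable]: "X \<in> borel_measurable M" "Z \<in> borel_measurable M"
    and X: "AE \<omega> in M. 0 \<le> X \<omega>" and Z: "AE \<omega> in M. 0 \<le> Z \<omega>"
    and le1: "\<And>x. 0 < x \<Longrightarrow> prob {\<omega> \<in> space M. x < X \<omega>} \<le> prob {\<omega> \<in> space M. x \<le> Z \<omega>}"
    and le2: "\<And>x. 0 < x \<Longrightarrow> prob {\<omega> \<in> space M. x \<le> Z \<omega>} \<le> prob {\<omega> \<in> space M. x \<le> X \<omega>}"
  shows "distr M borel X = distr M borel Z"
proof (rule cdf_unique)
  interpret X: real_distribution "distr M borel X" by simp
  interpret Z: real_distribution "distr M borel Z" by simp
  have cdf: "cdf (distr M borel U) y = prob {\<omega> \<in> space M. U \<omega> \<le> y}"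
    if [measurable]: "U \<in> borel_measurable M" for U y
    by (auto simp: cdf_def measure_distr vimage_def Int_def intro!: arg_cong[where f = prob])
  have less: "prob {\<omega> \<in> space M. U \<omega> < y} = 1 - prob {\<omega> \<in> space M. y \<le> U \<omega>}"
    and le: "prob {\<omega> \<in> space M. U \<omega> \<le> y} = 1 - prob {\<omega> \<in> space M. y < U \<omega>}"
    if [measurable]: "U \<in> borel_measurable M" for U :: "'a \<Rightarrow> real" and y
    by (auto simp: prob_compl[symmetric] intro!: arg_cong[where f = prob])
  have mono: "prob {\<omega> \<in> space M. U \<omega> \<le> y} \<le> prob {\<omega> \<in> space M. U \<omega> < z}"
    if [measurable]: "U \<in> borel_measurable M" and "y < z" for U :: "'a \<Rightarrow> real" and y z
    using \<open>y < z\<close> by (intro finite_measure_mono) auto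
  have mono': "prob {\<omega> \<in> space M. U \<omega> < z} \<le> prob {\<omega> \<in> space M. U \<omega> \<le> z}"
    if [measurable]: "U \<in> borel_measurable M" for U :: "'a \<Rightarrow> real" and z
    by (intro finite_measure_mono) auto
  have neg: "prob {\<omega> \<in> space M. U \<omega> \<le> y} = 0"
    if [measurable]: "U \<in> borel_measurable M" and "AE \<omega> in M. 0 \<le> U \<omega>" "y < 0" for U :: "'a \<Rightarrow> real" and y
  proof -
    have "prob {\<omega> \<in> space M. U \<omega> \<le> y} = prob {}"
      using \<open>AE \<omega> in M. 0 \<le> U \<omega>\<close> \<open>y < 0\<close>
      by (intro finite_measure_eq_AE) (auto elim!: eventually_mono)
    then show ?thesis by simp
  qed
  \<comment> \<open>Comparing at a point \<open>z > y\<close> absorbs the difference between strict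
    and nonstrict tails; it also makes \<open>z\<close> positive when \<open>y = 0\<close>, as the
    tail hypotheses require.\<close>
  have XZ: "cdf (distr M borel X) y \<le> cdf (distr M borel Z) z" if "0 \<le> y" "y < z" for y z
    using mono[of X y z] mono'[of Z z] le2[of z] that by (simp add: cdf less)
  have ZX: "cdf (distr M borel Z) y \<le> cdf (distr M borel X) z" if "0 \<le> y" "y < z" for y z
    using mono[of Z y z] le1[of z] that by (simp add: cdf less le)
  show "cdf (distr M borel X) = cdf (distr M borel Z)"
  proof
    fix y
    show "cdf (distr M borel X) y = cdf (distr M borel Z) y"
    proof (cases "0 \<le> y")
      case True
      have "cdf (distr M borel X) y \<le> cdf (distr M borel Z) y"
      proof (rule tendsto_lowerbound)
        show "((\<lambda>z. cdf (distr M borel Z) z) \<longlongrightarrow> cdf (distr M borel Z) y) (at_right y)"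
          using Z.cdf_is_right_cont[of y] by (simp add: continuous_within)
      qed (use eventually_mono[OF eventually_at_right_less[of y] XZ[OF True]] in simp_all)
      moreover have "cdf (distr M borel Z) y \<le> cdf (distr M borel X) y"
      proof (rule tendsto_lowerbound)
        show "((\<lambda>z. cdf (distr M borel X) z) \<longlongrightarrow> cdf (distr M borel X) y) (at_right y)"
          using X.cdf_is_right_cont[of y] by (simp add: continuous_within)
      qed (use eventually_mono[OF eventually_at_right_less[of y] ZX[OF True]] in simp_all)
      ultimately show ?thesis by simp
    qed (use neg X Z in \<open>simp add: cdf\<close>)
  qed
qed auto

text \<open>The tail bound at level 0 is \<open>exp (- (s powr \<beta>))\<close>, which vanishes as
  \<open>s\<close> grows.\<close>

lemma stable_subordinator_pos:
  assumes sub: "subordinator M (\<lambda>s. s powr \<beta>) D" and "0 < \<beta>"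
  shows "AE \<omega> in M. 0 < D 1 \<omega>"
proof -
  have [measurable]: "D 1 \<in> borel_measurable M"
    using subordinator_measurable[OF sub] by auto
  have "prob {\<omega> \<in> space M. D 1 \<omega> \<le> 0} \<le> exp (- (real (Suc k) powr \<beta>))" for k
    using subordinator_tail[OF sub, of 1 "real (Suc k)" 0] by simp
  moreover have "(\<lambda>k. exp (- (real (Suc k) powr \<beta>))) \<longlonglongrightarrow> 0"
    using \<open>0 < \<beta>\<close> by real_asymp
  ultimately have "prob {\<omega> \<in> space M. D 1 \<omega> \<le> 0} \<le> 0"
    by (intro LIMSEQ_le_const) auto
  then have "prob {\<omega> \<in> space M. D 1 \<omega> \<le> 0} = 0" by (simp add: measure_le_0_iff)
  then have "AE \<omega> in M. \<omega> \<notin> {\<omega> \<in> space M. D 1 \<omega> \<le> 0}"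
    by (intro AE_iff_measurable[THEN iffD2, OF _ refl]) (auto simp: emeasure_eq_measure)
  with AE_space show ?thesis by eventually_elim auto
qed

text \<open>Both Laplace transforms equal \<open>exp (- x * s powr \<beta>)\<close>, because raising
  \<open>s * x powr (1 / \<beta>)\<close> to the power \<open>\<beta>\<close> gives
  \<open>x * s powr \<beta>\<close>.\<close>

lemma stable_subordinator_scaling:
  assumes sub: "subordinator M (\<lambda>s. s powr \<beta>) D" and "0 < \<beta>" "0 < x"
  shows "distr M borel (D x) = distr M borel (\<lambda>\<omega>. x powr (1 / \<beta>) * D 1 \<omega>)"
proof (rule distr_eq_of_laplace)
  have [measurable]: "D 1 \<in> borel_measurable M" "D x \<in> borel_measurable M"
    using subordinator_measurable[OF sub] \<open>0 < x\<close> by auto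
  show "(\<lambda>\<omega>. x powr (1 / \<beta>) * D 1 \<omega>) \<in> borel_measurable M" "D x \<in> borel_measurable M"
    by measurable
  fix s :: real assume "0 < s"
  have "expectation (\<lambda>\<omega>. exp (- s * (x powr (1 / \<beta>) * D 1 \<omega>))) =
      expectation (\<lambda>\<omega>. exp (- (s * x powr (1 / \<beta>)) * D 1 \<omega>))"
    by (simp add: mult.assoc)
  also have "\<dots> = exp (- 1 * (s * x powr (1 / \<beta>)) powr \<beta>)"
    using sub \<open>0 < s\<close> \<open>0 < x\<close> unfolding subordinator_def by (metis mult_pos_pos powr_gt_zero less_irrefl zero_le_one)
  also have "\<dots> = exp (- x * s powr \<beta>)"
    using \<open>0 < s\<close> \<open>0 < x\<close> \<open>0 < \<beta>\<close> by (simp add: powr_mult powr_powr)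
  also have "\<dots> = expectation (\<lambda>\<omega>. exp (- s * D x \<omega>))"
    using sub \<open>0 < s\<close> \<open>0 < x\<close> by (simp add: subordinator_def)
  finally show "expectation (\<lambda>\<omega>. exp (- s * D x \<omega>)) =
      expectation (\<lambda>\<omega>. exp (- s * (x powr (1 / \<beta>) * D 1 \<omega>)))" by simp
next
  show "AE \<omega> in M. 0 \<le> D x \<omega>"
    using subordinator_nonneg[OF sub] by eventually_elim (use \<open>0 < x\<close> in simp)
  show "AE \<omega> in M. 0 \<le> x powr (1 / \<beta>) * D 1 \<omega>"
    using subordinator_nonneg[OF sub] by eventually_elim simp
qed

text \<open>Up to the boundary case, the inverse at \<open>r\<close> is at least \<open>x\<close>
  when \<open>D x \<le> r\<close>. By scaling this event has the probability of
  \<open>x powr (1 / \<beta>) * D 1 \<le> r\<close>, which says that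
  \<open>(r / D 1) powr \<beta>\<close> is at least \<open>x\<close>.\<close>

lemma inverse_stable_subordinator_distr:
  assumes sub: "subordinator M (\<lambda>s. s powr \<beta>) D" and "0 < \<beta>" "0 \<le> r"
    and E[measurable]: "inverse_subordinator D r \<in> borel_measurable M"
  shows "distr M borel (inverse_subordinator D r) = distr M borel (\<lambda>\<omega>. (r / D 1 \<omega>) powr \<beta>)"
proof (rule distr_eq_of_tail_squeeze)
  have D1[measurable]: "D 1 \<in> borel_measurable M"
    using subordinator_measurable[OF sub] by auto
  show "(\<lambda>\<omega>. (r / D 1 \<omega>) powr \<beta>) \<in> borel_measurable M" by measurable
  have unb: "AE \<omega> in M. \<forall>T. \<exists>r\<ge>0. T < D r \<omega>"
    by (rule subordinator_unbounded[OF sub zero_less_one]) simp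
  then show "AE \<omega> in M. 0 \<le> inverse_subordinator D r \<omega>"
    by eventually_elim (auto intro: inverse_subordinator_nonneg)
  fix x :: real assume "0 < x"
  have [measurable]: "D x \<in> borel_measurable M"
    using subordinator_measurable[OF sub] \<open>0 < x\<close> by auto
  have mono: "AE \<omega> in M. mono_on {0..} (\<lambda>t. D t \<omega>)"
    using sub by (auto simp: subordinator_def)
  have "prob {\<omega> \<in> space M. D x \<omega> \<le> r} = measure (distr M borel (D x)) {..r}"
    by (auto simp: measure_distr intro!: arg_cong[where f = prob])
  also have "\<dots> = prob {\<omega> \<in> space M. x powr (1 / \<beta>) * D 1 \<omega> \<le> r}"
    unfolding stable_subordinator_scaling[OF sub \<open>0 < \<beta>\<close> \<open>0 < x\<close>]
    by (auto simp: measure_distr intro!: arg_cong[where f = prob])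
  also have "\<dots> = prob {\<omega> \<in> space M. x \<le> (r / D 1 \<omega>) powr \<beta>}"
  proof (rule finite_measure_eq_AE)
    show "AE \<omega> in M. \<omega> \<in> {\<omega> \<in> space M. x powr (1 / \<beta>) * D 1 \<omega> \<le> r} \<longleftrightarrow>
        \<omega> \<in> {\<omega> \<in> space M. x \<le> (r / D 1 \<omega>) powr \<beta>}"
      using stable_subordinator_pos[OF sub \<open>0 < \<beta>\<close>]
    proof eventually_elim
      case (elim \<omega>)
      have "x powr (1 / \<beta>) * D 1 \<omega> \<le> r \<longleftrightarrow> x powr (1 / \<beta>) \<le> r / D 1 \<omega>"
        using elim by (simp add: field_simps)
      also have "\<dots> \<longleftrightarrow> (x powr (1 / \<beta>)) powr \<beta> \<le> (r / D 1 \<omega>) powr \<beta>"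
        using elim \<open>0 < \<beta>\<close> \<open>0 \<le> r\<close> by (intro powr_le_powr_iff[symmetric]) auto
      finally show ?case
        using \<open>0 < \<beta>\<close> \<open>0 < x\<close> by (simp add: powr_powr)
    qed
  qed measurable
  finally have eq: "prob {\<omega> \<in> space M. x \<le> (r / D 1 \<omega>) powr \<beta>} = prob {\<omega> \<in> space M. D x \<omega> \<le> r}" ..
  show "prob {\<omega> \<in> space M. x < inverse_subordinator D r \<omega>} \<le> prob {\<omega> \<in> space M. x \<le> (r / D 1 \<omega>) powr \<beta>}"
    unfolding eq using \<open>0 < x\<close>
    by (intro finite_measure_mono) (auto intro: inverse_subordinator_less_imp)
  show "prob {\<omega> \<in> space M. x \<le> (r / D 1 \<omega>) powr \<beta>} \<le> prob {\<omega> \<in> space M. x \<le> inverse_subordinator D r \<omega>}"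
    unfolding eq
  proof (rule finite_measure_mono_AE)
    show "AE \<omega> in M. \<omega> \<in> {\<omega> \<in> space M. D x \<omega> \<le> r} \<longrightarrow>
        \<omega> \<in> {\<omega> \<in> space M. x \<le> inverse_subordinator D r \<omega>}"
      using mono unb by eventually_elim (use \<open>0 < x\<close> in \<open>auto intro!: le_inverse_subordinator\<close>)
  qed measurable
next
  show "AE \<omega> in M. 0 \<le> (r / D 1 \<omega>) powr \<beta>" by simp
qed (rule E)

text \<open>Euler's integral writes \<open>Gamma p * D 1 powr (- p)\<close> as the integral of
  \<open>s powr (p - 1) * exp (- s * D 1)\<close>. By Tonelli the expectation can be taken inside,
  which produces the Laplace transform \<open>exp (- (s powr \<beta>))\<close>; its Mellin transform
  has been computed above.\<close>

lemma stable_subordinator_neg_moment: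
  assumes sub: "subordinator M (\<lambda>s. s powr \<beta>) D" and "0 < \<beta>" "0 < p"
  shows "integrable M (\<lambda>\<omega>. D 1 \<omega> powr (- p))"
    and "expectation (\<lambda>\<omega>. D 1 \<omega> powr (- p)) = Gamma (p / \<beta> + 1) / Gamma (p + 1)"
proof -
  interpret pair_sigma_finite M lborel ..
  have D1[measurable]: "D 1 \<in> borel_measurable M"
    using subordinator_measurable[OF sub] by auto
  have nonneg: "AE \<omega> in M. 0 \<le> D 1 \<omega>"
    using subordinator_nonneg[OF sub] by eventually_elim simp
  let ?g = "\<lambda>\<omega> s. ennreal (indicator {0..} s * s powr (p - 1) * exp (- s * D 1 \<omega>))"
  have "ennreal (Gamma p) * (\<integral>\<^sup>+\<omega>. ennreal (D 1 \<omega> powr (- p)) \<partial>M) =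
      (\<integral>\<^sup>+\<omega>. ennreal (Gamma p) * ennreal (D 1 \<omega> powr (- p)) \<partial>M)"
    by (rule nn_integral_cmult[symmetric]) measurable
  also have "\<dots> = (\<integral>\<^sup>+\<omega>. \<integral>\<^sup>+s. ?g \<omega> s \<partial>lborel \<partial>M)"
  proof (rule nn_integral_cong_AE)
    show "AE \<omega> in M. ennreal (Gamma p) * ennreal (D 1 \<omega> powr (- p)) = (\<integral>\<^sup>+s. ?g \<omega> s \<partial>lborel)"
      using stable_subordinator_pos[OF sub \<open>0 < \<beta>\<close>]
    proof eventually_elim
      case (elim \<omega>)
      show ?case
        unfolding nn_integral_powr_exp[OF \<open>0 < p\<close> elim] using \<open>0 < p\<close> by (simp add: ennreal_mult)
    qed
  qed
  also have "\<dots> = (\<integral>\<^sup>+s. \<integral>\<^sup>+\<omega>. ?g \<omega> s \<partial>M \<partial>lborel)"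
    by (rule Fubini'[symmetric]) measurable
  also have "\<dots> = (\<integral>\<^sup>+s. ennreal (indicator {0..} s * s powr (p - 1) * exp (- (s powr \<beta>))) \<partial>lborel)"
  proof (rule nn_integral_cong)
    fix s :: real
    show "(\<integral>\<^sup>+\<omega>. ?g \<omega> s \<partial>M) = ennreal (indicator {0..} s * s powr (p - 1) * exp (- (s powr \<beta>)))"
    proof (cases "0 < s")
      case True
      have "(\<integral>\<^sup>+\<omega>. ?g \<omega> s \<partial>M) = (\<integral>\<^sup>+\<omega>. ennreal (s powr (p - 1)) * ennreal (exp (- s * D 1 \<omega>)) \<partial>M)"
        using True by (intro nn_integral_cong) (simp add: ennreal_mult)
      also have "\<dots> = ennreal (s powr (p - 1)) * (\<integral>\<^sup>+\<omega>. ennreal (exp (- s * D 1 \<omega>)) \<partial>M)"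
        by (rule nn_integral_cmult) measurable
      also have "(\<integral>\<^sup>+\<omega>. ennreal (exp (- s * D 1 \<omega>)) \<partial>M) = ennreal (expectation (\<lambda>\<omega>. exp (- s * D 1 \<omega>)))"
        using True nonneg by (intro nn_integral_eq_integral integrable_exp_neg) auto
      also have "expectation (\<lambda>\<omega>. exp (- s * D 1 \<omega>)) = exp (- 1 * s powr \<beta>)"
        using sub True unfolding subordinator_def by (meson zero_le_one)
      finally show ?thesis using True by (simp add: ennreal_mult)
    next
      case False
      \<comment> \<open>At \<open>s = 0\<close> both integrands vanish because
        \<open>0 powr a = 0\<close>; for negative \<open>s\<close> the indicator vanishes.\<close>
      then show ?thesis by (cases "s = 0") (auto simp: indicator_def)
    qed
  qed
  also have "\<dots> = ennreal (Gamma (p / \<beta> + 1) / p)"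
    using nn_integral_powr_exp_neg_powr[OF \<open>0 < p\<close> \<open>0 < \<beta>\<close>] .
  finally have *: "ennreal (Gamma p) * (\<integral>\<^sup>+\<omega>. ennreal (D 1 \<omega> powr (- p)) \<partial>M) = ennreal (Gamma (p / \<beta> + 1) / p)" .
  have G: "0 < Gamma p" "0 < Gamma (p / \<beta> + 1)" "Gamma (p + 1) = p * Gamma p"
    using assms by (auto intro!: Gamma_real_pos add_pos_pos Gamma_plus1 elim!: nonpos_Ints_cases)
  have "(\<integral>\<^sup>+\<omega>. ennreal (D 1 \<omega> powr (- p)) \<partial>M) =
      ennreal (1 / Gamma p) * (ennreal (Gamma p) * (\<integral>\<^sup>+\<omega>. ennreal (D 1 \<omega> powr (- p)) \<partial>M))"
    using G by (simp add: mult.assoc[symmetric] ennreal_mult[symmetric])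
  also have "\<dots> = ennreal (Gamma (p / \<beta> + 1) / Gamma (p + 1))"
    unfolding * using G \<open>0 < p\<close> by (simp add: ennreal_mult[symmetric])
  finally have "(\<integral>\<^sup>+\<omega>. ennreal (D 1 \<omega> powr (- p)) \<partial>M) = ennreal (Gamma (p / \<beta> + 1) / Gamma (p + 1))" .
  then have "integrable M (\<lambda>\<omega>. D 1 \<omega> powr (- p)) \<and>
      expectation (\<lambda>\<omega>. D 1 \<omega> powr (- p)) = Gamma (p / \<beta> + 1) / Gamma (p + 1)"
    using G \<open>0 < p\<close> by (subst (asm) nn_integral_eq_integrable) auto
  then show "integrable M (\<lambda>\<omega>. D 1 \<omega> powr (- p))"
    "expectation (\<lambda>\<omega>. D 1 \<omega> powr (- p)) = Gamma (p / \<beta> + 1) / Gamma (p + 1)" by auto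
qed

lemma inverse_stable_subordinator_moment:
  assumes sub: "subordinator M (\<lambda>s. s powr \<beta>) D" and "0 < \<beta>" "0 \<le> r"
    and [measurable]: "inverse_subordinator D r \<in> borel_measurable M"
  shows "expectation (\<lambda>\<omega>. inverse_subordinator D r \<omega> ^ m) =
    fact m / Gamma (\<beta> * real m + 1) * real_power r (\<beta> * real m)"
\<comment> \<open>The negative moment formula needs a positive exponent \<open>\<beta> * m\<close>.
  For \<open>m = 0\<close> the claim is that the total mass is 1, with the convention
  \<open>0^0 = 1\<close> of \<open>real_power\<close>.\<close>
proof (cases "m = 0")
  case True
  then show ?thesis by (simp add: real_power_def prob_space)
next
  case False
  then have p: "0 < \<beta> * real m" using \<open>0 < \<beta>\<close> by simp
  have [measurable]: "D 1 \<in> borel_measurable M"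
    using subordinator_measurable[OF sub] by auto
  have "expectation (\<lambda>\<omega>. inverse_subordinator D r \<omega> ^ m) =
      (\<integral>x. x ^ m \<partial>distr M borel (inverse_subordinator D r))"
    by (simp add: integral_distr)
  also have "\<dots> = expectation (\<lambda>\<omega>. ((r / D 1 \<omega>) powr \<beta>) ^ m)"
    using assms by (simp add: inverse_stable_subordinator_distr integral_distr)
  also have "\<dots> = expectation (\<lambda>\<omega>. r powr (\<beta> * real m) * D 1 \<omega> powr (- (\<beta> * real m)))"
  proof (rule integral_cong_AE)
    show "AE \<omega> in M. ((r / D 1 \<omega>) powr \<beta>) ^ m = r powr (\<beta> * real m) * D 1 \<omega> powr (- (\<beta> * real m))"
      using stable_subordinator_pos[OF sub \<open>0 < \<beta>\<close>]
    proof eventually_elim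
      case (elim \<omega>)
      have pow: "(x powr \<beta>) ^ m = x powr (\<beta> * real m)" for x
        using False by (cases "x = 0") (simp_all add: powr_realpow[symmetric] powr_powr)
      show ?case
        unfolding pow using elim \<open>0 \<le> r\<close> by (simp add: powr_divide powr_minus_divide)
    qed
  qed measurable
  also have "\<dots> = r powr (\<beta> * real m) * (Gamma (\<beta> * real m / \<beta> + 1) / Gamma (\<beta> * real m + 1))"
    using stable_subordinator_neg_moment[OF sub \<open>0 < \<beta>\<close> p] by simp
  also have "Gamma (\<beta> * real m / \<beta> + 1) = fact m"
    using \<open>0 < \<beta>\<close> Gamma_fact[of m, where 'a = real] by (simp add: add.commute)
  finally show ?thesis using p False \<open>0 < \<beta>\<close> by (simp add: real_power_def)
qed

end

section \<open>Independent time changes\<close>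

text \<open>
  The grid point lies strictly to the right of \<open>x\<close>, so that right-continuous paths converge along it
  even where they jump.
\<close>

definition right_grid :: "nat \<Rightarrow> real \<Rightarrow> real" where
  "right_grid m x = (real (nat \<lfloor>real (Suc m) * x\<rfloor>) + 1) / real (Suc m)"

lemma right_grid_pos: "0 < right_grid m x"
  by (simp add: right_grid_def add_nonneg_pos)

lemma right_grid_measurable [measurable]: "right_grid m \<in> borel_measurable borel"
  unfolding right_grid_def[abs_def] by measurable

lemma right_grid_bounds:
  assumes "0 \<le> x"
  shows "x < right_grid m x" "right_grid m x \<le> x + 1 / real (Suc m)"
proof -
  have eq: "real (nat \<lfloor>real (Suc m) * x\<rfloor>) = of_int \<lfloor>real (Suc m) * x\<rfloor>"
    using assms by (intro of_nat_nat) (simp del: of_nat_Suc)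
  have "real (Suc m) * x < of_int \<lfloor>real (Suc m) * x\<rfloor> + 1"
    "of_int \<lfloor>real (Suc m) * x\<rfloor> \<le> real (Suc m) * x"
    by linarith+
  then show "x < right_grid m x" "right_grid m x \<le> x + 1 / real (Suc m)"
    unfolding right_grid_def eq by (simp_all add: field_simps del: of_nat_Suc)
qed

lemma filterlim_right_grid:
  assumes "0 \<le> x"
  shows "filterlim (\<lambda>m. right_grid m x) (at_right x) sequentially"
proof -
  have "(\<lambda>m. right_grid m x) \<longlonglongrightarrow> x"
  proof (rule tendsto_sandwich[where f = "\<lambda>_. x" and h = "\<lambda>m. x + 1 / real (Suc m)"])
    show "(\<lambda>m. x + 1 / real (Suc m)) \<longlonglongrightarrow> x" by real_asymp
    show "\<forall>\<^sub>F m in sequentially. x \<le> right_grid m x"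
      using right_grid_bounds(1)[OF assms] by (intro always_eventually) (auto intro: less_imp_le)
    show "\<forall>\<^sub>F m in sequentially. right_grid m x \<le> x + 1 / real (Suc m)"
      using right_grid_bounds(2)[OF assms] by (intro always_eventually allI)
  qed auto
  then show ?thesis
    using right_grid_bounds(1)[OF assms] by (intro tendsto_imp_filterlim_at_right) auto
qed

lemma eventually_eq_of_tendsto_nat:
  fixes y :: "'b \<Rightarrow> nat"
  assumes "((\<lambda>x. real (y x)) \<longlongrightarrow> real l) F"
  shows "\<forall>\<^sub>F x in F. y x = l"
  using tendstoD[OF assms zero_less_one]
proof eventually_elim
  case (elim x)
  then have "\<bar>real (y x) - real l\<bar> < 1" by (simp add: dist_real_def)
  then show ?case by linarith
qed

section \<open>The mixture formula at an independent random time\<close>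

context prob_space
begin

lemma prob_tendsto_of_AE_eventually_iff:
  assumes [measurable]: "\<And>m::nat. {\<omega> \<in> space M. P m \<omega>} \<in> events" "{\<omega> \<in> space M. Q \<omega>} \<in> events"
    and ev: "AE \<omega> in M. \<forall>\<^sub>F m in sequentially. P m \<omega> \<longleftrightarrow> Q \<omega>"
  shows "(\<lambda>m. prob {\<omega> \<in> space M. P m \<omega>}) \<longlonglongrightarrow> prob {\<omega> \<in> space M. Q \<omega>}"
proof -
  have "(\<lambda>m. \<integral>\<omega>. indicator {\<omega> \<in> space M. P m \<omega>} \<omega> \<partial>M) \<longlonglongrightarrow>
      (\<integral>\<omega>. indicator {\<omega> \<in> space M. Q \<omega>} \<omega> \<partial>M :: real)"
  proof (rule integral_dominated_convergence[where w = "\<lambda>_. 1"])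
    show "AE \<omega> in M. (\<lambda>m. indicator {\<omega> \<in> space M. P m \<omega>} \<omega> :: real)
        \<longlonglongrightarrow> indicator {\<omega> \<in> space M. Q \<omega>} \<omega>"
      using ev
    proof eventually_elim
      case (elim \<omega>)
      then show ?case
        by (intro tendsto_eventually) (auto elim!: eventually_mono simp: indicator_def)
    qed
  qed (auto simp: indicator_def)
  then show ?thesis by simp
qed

text \<open>Here \<open>q\<close> is a measurable function on the reals that gives the probability
  of \<open>Y r = n\<close> at each \<open>r \<ge> 0\<close>. Independence is used only at grid
  times; right continuity of the paths of \<open>Y\<close> carries the formula to the limit.\<close>

lemma prob_time_change:
  fixes X :: "real \<Rightarrow> 'a \<Rightarrow> real" and Y :: "real \<Rightarrow> 'a \<Rightarrow> nat"
  assumes indep: "indep_processes M X (\<lambda>t \<omega>. real (Y t \<omega>))" and "0 \<le> t"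
    and nonneg: "AE \<omega> in M. 0 \<le> X t \<omega>"
    and rc: "AE \<omega> in M. \<forall>t\<ge>0. ((\<lambda>s. real (Y s \<omega>)) \<longlongrightarrow> real (Y t \<omega>)) (at_right t)"
    and W: "{\<omega> \<in> space M. Y (X t \<omega>) \<omega> = n} \<in> events"
    and q[measurable]: "q \<in> borel_measurable borel"
    and q_eq: "\<And>r. 0 \<le> r \<Longrightarrow> prob {\<omega> \<in> space M. Y r \<omega> = n} = q r"
  shows "prob {\<omega> \<in> space M. Y (X t \<omega>) \<omega> = n} = expectation (\<lambda>\<omega>. q (X t \<omega>))"
proof -
  let ?P = "PiM {0..} (\<lambda>_. borel) :: (real \<Rightarrow> real) measure"
  let ?X = "\<lambda>\<omega>. \<lambda>t\<in>{0..}. X t \<omega>" and ?Y = "\<lambda>\<omega>. \<lambda>t\<in>{0..}. real (Y t \<omega>)"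
  have X[measurable]: "?X \<in> measurable M ?P" and Y[measurable]: "?Y \<in> measurable M ?P"
    and prod: "distr M ?P ?X \<Otimes>\<^sub>M distr M ?P ?Y = distr M (?P \<Otimes>\<^sub>M ?P) (\<lambda>\<omega>. (?X \<omega>, ?Y \<omega>))"
    using indep by (auto simp: indep_processes_def indep_var_distribution_eq)
  have comp[measurable]: "(\<lambda>x. x t) \<in> borel_measurable ?P"
    using \<open>0 \<le> t\<close> by (intro measurable_component_singleton) auto
  have Xt: "?X \<omega> t = X t \<omega>" for \<omega>
    using \<open>0 \<le> t\<close> by simp
  have [measurable]: "X t \<in> borel_measurable M"
    using measurable_compose[OF X comp] unfolding Xt .
  have Yr: "{\<omega> \<in> space M. Y r \<omega> = n} \<in> events" if "0 \<le> r" for r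
  proof -
    have "(\<lambda>\<omega>. ?Y \<omega> r) \<in> borel_measurable M"
      using that by (intro measurable_compose[OF Y measurable_component_singleton]) auto
    then have [measurable]: "(\<lambda>\<omega>. real (Y r \<omega>)) \<in> borel_measurable M"
      using that by simp
    have "{\<omega> \<in> space M. real (Y r \<omega>) = real n} \<in> events"
      by measurable
    then show ?thesis by simp
  qed
  interpret X: prob_space "distr M ?P ?X" by (rule prob_space_distr) simp
  interpret Y: prob_space "distr M ?P ?Y" by (rule prob_space_distr) simp
  interpret XY: pair_prob_space "distr M ?P ?X" "distr M ?P ?Y" ..
  have pos: "0 \<le> right_grid m x" for m x using right_grid_pos[of m x] by simp
  \<comment> \<open>On the product of the two path spaces, evaluating one path at a time read off
    the other need not be measurable. On the grid only countably many times occur, and joint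
    measurability follows.\<close>
  define G where "G m p = (indicator {real n} (snd p (right_grid m (fst p t))) :: real)"
    for m and p :: "(real \<Rightarrow> real) \<times> (real \<Rightarrow> real)"
  have G[measurable]: "G m \<in> borel_measurable (?P \<Otimes>\<^sub>M ?P)" for m
  proof -
    have "(\<lambda>p. indicator {real n} (snd p ((real (nat \<lfloor>real (Suc m) * fst p t\<rfloor>) + 1) / real (Suc m))))
      \<in> measurable (?P \<Otimes>\<^sub>M ?P) (borel :: real measure)"
    proof (rule measurable_compose_countable[where
          f = "\<lambda>i p. indicator {real n} (snd p ((real i + 1) / real (Suc m)))"])
      fix i :: nat
      have [measurable]: "(\<lambda>p. snd p ((real i + 1) / real (Suc m))) \<in> borel_measurable (?P \<Otimes>\<^sub>M ?P)"
        by (intro measurable_compose[OF measurable_snd measurable_component_singleton]) simp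
      show "(\<lambda>p. indicator {real n} (snd p ((real i + 1) / real (Suc m))) :: real)
          \<in> borel_measurable (?P \<Otimes>\<^sub>M ?P)"
        by measurable
    qed measurable
    then show ?thesis by (simp add: G_def[abs_def] right_grid_def)
  qed
  have G_eq: "G m (x, ?Y \<omega>) = indicator {\<omega> \<in> space M. Y (right_grid m (x t)) \<omega> = n} \<omega>"
    if "\<omega> \<in> space M" for m x \<omega>
    using that pos[of m "x t"] by (auto simp: G_def indicator_def)
  have grid: "prob {\<omega> \<in> space M. Y (right_grid m (X t \<omega>)) \<omega> = n} = expectation (\<lambda>\<omega>. q (right_grid m (X t \<omega>)))" for m
  proof -
    have "prob {\<omega> \<in> space M. Y (right_grid m (X t \<omega>)) \<omega> = n} = (\<integral>\<omega>. G m (?X \<omega>, ?Y \<omega>) \<partial>M)"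
    proof -
      have "(\<integral>\<omega>. G m (?X \<omega>, ?Y \<omega>) \<partial>M) =
          (\<integral>\<omega>. indicator {\<omega> \<in> space M. Y (right_grid m (X t \<omega>)) \<omega> = n} \<omega> \<partial>M)"
        by (intro Bochner_Integration.integral_cong refl) (simp add: G_eq \<open>0 \<le> t\<close> indicator_def)
      then show ?thesis by (simp add: Int_absorb2 subset_eq)
    qed
    also have "\<dots> = (\<integral>p. G m p \<partial>(distr M ?P ?X \<Otimes>\<^sub>M distr M ?P ?Y))"
      unfolding prod by (subst integral_distr) auto
    also have "\<dots> = (\<integral>x. \<integral>y. G m (x, y) \<partial>distr M ?P ?Y \<partial>distr M ?P ?X)"
    proof (rule XY.integral_fst'[symmetric])
      show "integrable (distr M ?P ?X \<Otimes>\<^sub>M distr M ?P ?Y) (G m)"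
        by (rule XY.integrable_const_bound[where B = 1]) (auto simp: G_def indicator_def)
    qed
    also have "\<dots> = (\<integral>x. q (right_grid m (x t)) \<partial>distr M ?P ?X)"
    proof (intro Bochner_Integration.integral_cong refl)
      fix x assume "x \<in> space (distr M ?P ?X)"
      then have "(\<lambda>y. G m (x, y)) \<in> borel_measurable ?P"
        using measurable_Pair2[OF G] by simp
      then have "(\<integral>y. G m (x, y) \<partial>distr M ?P ?Y) = (\<integral>\<omega>. G m (x, ?Y \<omega>) \<partial>M)"
        by (subst integral_distr) auto
      also have "\<dots> = (\<integral>\<omega>. indicator {\<omega> \<in> space M. Y (right_grid m (x t)) \<omega> = n} \<omega> \<partial>M)"
        by (intro Bochner_Integration.integral_cong refl G_eq)
      also have "\<dots> = prob {\<omega> \<in> space M. Y (right_grid m (x t)) \<omega> = n}"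
        by (simp add: Int_absorb2 subset_eq)
      finally show "(\<integral>y. G m (x, y) \<partial>distr M ?P ?Y) = q (right_grid m (x t))"
        using q_eq[OF pos] by simp
    qed
    also have "\<dots> = expectation (\<lambda>\<omega>. q (right_grid m (X t \<omega>)))"
      using \<open>0 \<le> t\<close> by (subst integral_distr[OF X measurable_compose[OF comp]]) auto
    finally show ?thesis .
  qed
  have ev: "\<forall>\<^sub>F m in sequentially. Y (right_grid m x) \<omega> = Y x \<omega>"
    if "0 \<le> x" "\<forall>t\<ge>0. ((\<lambda>s. real (Y s \<omega>)) \<longlongrightarrow> real (Y t \<omega>)) (at_right t)" for x \<omega>
    using that by (intro eventually_eq_of_tendsto_nat filterlim_compose[OF _ filterlim_right_grid]) auto
  have "(\<lambda>m. prob {\<omega> \<in> space M. Y (right_grid m (X t \<omega>)) \<omega> = n}) \<longlonglongrightarrow>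
      prob {\<omega> \<in> space M. Y (X t \<omega>) \<omega> = n}"
  proof (rule prob_tendsto_of_AE_eventually_iff)
    show "{\<omega> \<in> space M. Y (right_grid m (X t \<omega>)) \<omega> = n} \<in> events" for m
    proof -
      have "{\<omega> \<in> space M. G m (?X \<omega>, ?Y \<omega>) = 1} \<in> events" by measurable
      also have "{\<omega> \<in> space M. G m (?X \<omega>, ?Y \<omega>) = 1} = {\<omega> \<in> space M. Y (right_grid m (X t \<omega>)) \<omega> = n}"
        using \<open>0 \<le> t\<close> by (auto simp: G_eq indicator_def)
      finally show ?thesis .
    qed
    show "AE \<omega> in M. \<forall>\<^sub>F m in sequentially. (Y (right_grid m (X t \<omega>)) \<omega> = n) = (Y (X t \<omega>) \<omega> = n)"
      using nonneg rc
    proof eventually_elim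
      case (elim \<omega>)
      from ev[OF this] show ?case by (rule eventually_mono) simp
    qed
  qed (rule W)
  moreover have "(\<lambda>m. expectation (\<lambda>\<omega>. q (right_grid m (X t \<omega>)))) \<longlonglongrightarrow> expectation (\<lambda>\<omega>. q (X t \<omega>))"
  proof (rule integral_dominated_convergence[where w = "\<lambda>_. 1"])
    \<comment> \<open>Convergence of \<open>q\<close> along the grid is inherited from the paths: at
      a fixed time, \<open>Y\<close> takes its limiting value eventually, and dominated convergence
      passes to probabilities.\<close>
    have lim: "(\<lambda>m. q (right_grid m x)) \<longlonglongrightarrow> q x" if "0 \<le> x" for x
    proof -
      have "(\<lambda>m. prob {\<omega> \<in> space M. Y (right_grid m x) \<omega> = n}) \<longlonglongrightarrow> prob {\<omega> \<in> space M. Y x \<omega> = n}"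
      proof (rule prob_tendsto_of_AE_eventually_iff)
        show "AE \<omega> in M. \<forall>\<^sub>F m in sequentially. (Y (right_grid m x) \<omega> = n) = (Y x \<omega> = n)"
          using rc
        proof eventually_elim
          case (elim \<omega>)
          from ev[OF that this] show ?case by (rule eventually_mono) simp
        qed
      qed (use Yr pos that in auto)
      then show ?thesis using q_eq that pos by simp
    qed
    show "AE \<omega> in M. (\<lambda>m. q (right_grid m (X t \<omega>))) \<longlonglongrightarrow> q (X t \<omega>)"
      using nonneg by eventually_elim (rule lim)
    \<comment> \<open>Grid points are positive, so the values of \<open>q\<close> there are
      probabilities.\<close>
    show "AE \<omega> in M. norm (q (right_grid m (X t \<omega>))) \<le> 1" for m
      using pos by (auto simp flip: q_eq)
  qed auto
  ultimately show ?thesis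
    unfolding grid by (rule LIMSEQ_unique)
qed

end

section \<open>Mittag-Leffler type series\<close>

text \<open>On \<open>y \<ge> x\<close> the integrand of \<open>Gamma (p + 1)\<close> is at least
  \<open>x powr p * exp (- y)\<close>, whose integral over that range is
  \<open>x powr p * exp (- x)\<close>.\<close>

lemma powr_le_Gamma_exp:
  fixes x p :: real assumes "0 \<le> p" "0 \<le> x"
  shows "x powr p \<le> Gamma (p + 1) * exp x"
proof -
  have G: "((\<lambda>y. y powr p / exp y) has_integral Gamma (p + 1)) {0..}"
    using Gamma_integral_real[of "p + 1"] assms by simp
  have E: "((\<lambda>y. x powr p * exp (- 1 * y)) has_integral x powr p * (exp (- 1 * x) / 1)) {x..}"
    by (intro has_integral_mult_right has_integral_exp_minus_to_infinity) auto
  have "x powr p * (exp (- 1 * x) / 1) \<le> Gamma (p + 1)"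
  proof (rule has_integral_le)
    show "((\<lambda>y. if y \<in> {x..} then x powr p * exp (- 1 * y) else 0) has_integral
        x powr p * (exp (- 1 * x) / 1)) {0..}"
      using E assms by (subst has_integral_restrict) auto
  qed (use G assms in \<open>auto intro!: powr_mono2 simp: exp_minus field_simps\<close>)
  then show ?thesis by (simp add: exp_minus field_simps)
qed

section \<open>The power series of the probabilities and its termwise expectation\<close>

definition fpp_coeff :: "real \<Rightarrow> real \<Rightarrow> nat \<Rightarrow> nat \<Rightarrow> real" where
  "fpp_coeff \<beta> lam n k = fact (n + k) / fact k * ((- lam) ^ k / Gamma (\<beta> * real (k + n) + 1))"

text \<open>For \<open>x \<ge> 0\<close> and positive \<open>\<beta>\<close> this is
  \<open>x^(\<beta> n)\<close> times the n-th derivative of the Mittag-Leffler function with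
  parameter \<open>\<beta>\<close>, evaluated at \<open>- lam * x^\<beta>\<close>.\<close>

definition fpp_series :: "real \<Rightarrow> real \<Rightarrow> nat \<Rightarrow> real \<Rightarrow> real" where
  "fpp_series \<beta> lam n x = (\<Sum>k. fpp_coeff \<beta> lam n k * real_power x (\<beta> * real (n + k)))"

lemma real_power_measurable [measurable]: "(\<lambda>x. real_power x a) \<in> borel_measurable borel"
  unfolding real_power_def by measurable

lemma fpp_series_measurable [measurable]: "fpp_series \<beta> lam n \<in> borel_measurable borel"
  unfolding fpp_series_def[abs_def] by measurable

lemma real_power_nonneg: "0 \<le> real_power x a"
  by (simp add: real_power_def)

lemma real_power_of_nat: "0 \<le> x \<Longrightarrow> real_power x (real m) = x ^ m"
  by (cases "x = 0") (auto simp: real_power_def powr_realpow)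

lemma real_power_mult: "0 \<le> x \<Longrightarrow> 0 \<le> y \<Longrightarrow> real_power (x * y) a = real_power x a * real_power y a"
  by (simp add: real_power_def powr_mult)

lemma real_power_le_Gamma_exp:
  assumes "0 \<le> p" "0 \<le> x"
  shows "real_power x p \<le> Gamma (p + 1) * exp x"
  using powr_le_Gamma_exp[OF assms] assms by (simp add: real_power_def)

text \<open>The exponential rate is chosen such that its power \<open>\<beta>\<close> is \<open>4 * lam\<close>.\<close>

lemma fpp_coeff_bound:
  assumes "0 < \<beta>" "0 < lam" "0 \<le> x"
  shows "\<bar>fpp_coeff \<beta> lam n k\<bar> * real_power x (\<beta> * real (n + k)) \<le>
    fact n / (2 * lam) ^ n * exp ((4 * lam) powr (1 / \<beta>) * x) * (1 / 2) ^ k"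
proof -
  define a p where "a = (4 * lam) powr (1 / \<beta>)" and "p = \<beta> * real (n + k)"
  have p: "0 \<le> p" and "0 < a" using assms by (auto simp: p_def a_def)
  then have G: "0 < Gamma (p + 1)" by (intro Gamma_real_pos) simp
  have "real_power a p = (4 * lam) ^ (n + k)"
  proof (cases "n + k = 0")
    case False
    then have "real_power a p = (4 * lam) powr real (n + k)"
      using assms by (simp add: real_power_def a_def p_def powr_powr)
    then show ?thesis using assms by (simp only: powr_realpow mult_pos_pos zero_less_numeral)
  qed (simp add: p_def real_power_def)
  then have "(4 * lam) ^ (n + k) * real_power x p \<le> Gamma (p + 1) * exp (a * x)"
    using real_power_le_Gamma_exp[OF p, of "a * x"] \<open>0 < a\<close> \<open>0 \<le> x\<close> by (simp add: real_power_mult)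
  then have x: "real_power x p \<le> Gamma (p + 1) * exp (a * x) / (4 * lam) ^ (n + k)"
    using \<open>0 < lam\<close> by (simp add: field_simps)
  have "fact k * fact n * (n + k choose k) = fact (n + k)"
    using binomial_fact_lemma[of k "n + k"] by simp
  then have "(fact (n + k) :: real) = fact n * fact k * real (n + k choose k)"
    by (metis mult.commute of_nat_fact of_nat_mult)
  also have "\<dots> \<le> fact n * fact k * real (2 ^ (n + k))"
    by (intro mult_left_mono of_nat_mono binomial_le_pow2) simp
  finally have f: "fact (n + k) / fact k \<le> (fact n * 2 ^ (n + k) :: real)"
    by (simp add: field_simps)
  have c: "\<bar>fpp_coeff \<beta> lam n k\<bar> = fact (n + k) / fact k * (lam ^ k / Gamma (p + 1))"
    using \<open>0 < lam\<close> G by (simp add: fpp_coeff_def p_def abs_mult power_abs add.commute)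
  have "\<bar>fpp_coeff \<beta> lam n k\<bar> * real_power x p \<le>
      (fact n * 2 ^ (n + k)) * (lam ^ k / Gamma (p + 1)) * (Gamma (p + 1) * exp (a * x) / (4 * lam) ^ (n + k))"
    unfolding c using G \<open>0 < lam\<close>
    by (intro mult_mono[OF mult_right_mono[OF f] x _ real_power_nonneg]) auto
  \<comment> \<open>Of the two factors 2 in 4, one cancels the bound on the binomial coefficient and
    the other provides the geometric decay.\<close>
  also have "\<dots> = fact n / (2 * lam) ^ n * exp (a * x) * (1 / 2) ^ k"
  proof -
    have four: "(4::real) ^ j = 2 ^ j * 2 ^ j" for j
      by (simp flip: power_mult_distrib)
    show ?thesis using \<open>0 < lam\<close> G by (simp add: power_mult_distrib power_add four field_simps)
  qed
  finally show ?thesis unfolding a_def p_def .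
qed

text \<open>The coefficient bound is geometric in \<open>k\<close> with a prefactor exponential in
  \<open>X\<close>. The exponential moments make this prefactor integrable, which justifies
  exchanging sum and expectation.\<close>

lemma (in prob_space)
  fixes X :: "'a \<Rightarrow> real"
  assumes [measurable]: "X \<in> borel_measurable M" and nonneg: "AE \<omega> in M. 0 \<le> X \<omega>"
    and exp: "\<And>a. 0 \<le> a \<Longrightarrow> integrable M (\<lambda>\<omega>. exp (a * X \<omega>))"
    and "0 < \<beta>" "0 < lam"
  shows integrable_real_power: "integrable M (\<lambda>\<omega>. real_power (X \<omega>) (\<beta> * real (n + k)))"
    and fpp_series_sums_expectation:
      "(\<lambda>k. fpp_coeff \<beta> lam n k * expectation (\<lambda>\<omega>. real_power (X \<omega>) (\<beta> * real (n + k)))) sums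
        expectation (\<lambda>\<omega>. fpp_series \<beta> lam n (X \<omega>))"
proof -
  show int: "integrable M (\<lambda>\<omega>. real_power (X \<omega>) (\<beta> * real (n + k)))" for k
  proof (rule Bochner_Integration.integrable_bound[OF integrable_mult_right[OF exp[OF zero_le_one]]])
    show "AE \<omega> in M. norm (real_power (X \<omega>) (\<beta> * real (n + k))) \<le>
        norm (Gamma (\<beta> * real (n + k) + 1) * exp (1 * X \<omega>))"
      using nonneg
    proof eventually_elim
      case (elim \<omega>)
      have "real_power (X \<omega>) (\<beta> * real (n + k)) \<le> Gamma (\<beta> * real (n + k) + 1) * exp (1 * X \<omega>)"
        using real_power_le_Gamma_exp[of "\<beta> * real (n + k)" "X \<omega>"] elim \<open>0 < \<beta>\<close> by simp
      with real_power_nonneg show ?case unfolding real_norm_def by (metis abs_ge_self abs_of_nonneg order_trans)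
    qed
  qed measurable
  define B where "B = fact n / (2 * lam) ^ n"
  define a where "a = (4 * lam) powr (1 / \<beta>)"
  let ?f = "\<lambda>k \<omega>. fpp_coeff \<beta> lam n k * real_power (X \<omega>) (\<beta> * real (n + k))"
  have geom: "summable (\<lambda>k. C * (1 / 2) ^ k)" for C :: real
    by (intro summable_mult summable_geometric) simp
  have norm: "norm (?f k \<omega>) = \<bar>fpp_coeff \<beta> lam n k\<bar> * real_power (X \<omega>) (\<beta> * real (n + k))" for k \<omega>
    using real_power_nonneg[of "X \<omega>" "\<beta> * real (n + k)"] by (simp add: abs_mult)
  have bound: "AE \<omega> in M. \<forall>k. norm (?f k \<omega>) \<le> B * exp (a * X \<omega>) * (1 / 2) ^ k"
    using nonneg
    by eventually_elim (unfold norm B_def a_def, intro allI fpp_coeff_bound \<open>0 < \<beta>\<close> \<open>0 < lam\<close>)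
  have "(\<lambda>k. \<integral>\<omega>. ?f k \<omega> \<partial>M) sums (\<integral>\<omega>. (\<Sum>k. ?f k \<omega>) \<partial>M)"
  proof (rule sums_integral)
    show fint: "integrable M (?f k)" for k
      by (intro integrable_mult_right int)
    show "AE \<omega> in M. summable (\<lambda>k. norm (?f k \<omega>))"
      using bound
    proof eventually_elim
      case (elim \<omega>)
      then show ?case
        by (intro summable_comparison_test'[OF geom[of "B * exp (a * X \<omega>)"]]) simp
    qed
    have "(\<integral>\<omega>. norm (?f k \<omega>) \<partial>M) \<le> (B * expectation (\<lambda>\<omega>. exp (a * X \<omega>))) * (1 / 2) ^ k" for k
    proof -
      have "(\<integral>\<omega>. norm (?f k \<omega>) \<partial>M) \<le> (\<integral>\<omega>. B * exp (a * X \<omega>) * (1 / 2) ^ k \<partial>M)"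
        using bound exp[of a]
        by (intro integral_mono_AE integrable_norm fint integrable_mult_left integrable_mult_right)
          (auto simp: a_def elim: eventually_mono)
      then show ?thesis by simp
    qed
    then show "summable (\<lambda>k. \<integral>\<omega>. norm (?f k \<omega>) \<partial>M)"
      by (intro summable_comparison_test'[OF geom]) simp
  qed
  then show "(\<lambda>k. fpp_coeff \<beta> lam n k * expectation (\<lambda>\<omega>. real_power (X \<omega>) (\<beta> * real (n + k)))) sums
      expectation (\<lambda>\<omega>. fpp_series \<beta> lam n (X \<omega>))"
    using int by (simp add: fpp_series_def)
qed

text \<open>At \<open>\<beta> = 1\<close> the Gamma values cancel the factorials and an exponential
  series remains. This settles the Poisson case and also allows Poisson weights at a random time to
  be expanded in moments.\<close>

lemma fpp_series_1:
  assumes "0 \<le> x"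
  shows "lam ^ n / fact n * fpp_series 1 lam n x = (lam * x) ^ n / fact n * exp (- (lam * x))"
proof -
  have "fpp_coeff 1 lam n k * real_power x (1 * real (n + k)) = x ^ n * ((- (lam * x)) ^ k /\<^sub>R fact k)" for k
  proof -
    have "Gamma (1 * real (k + n) + 1) = fact (n + k)"
      using Gamma_fact[of "n + k", where 'a = real] by (simp add: add_ac)
    moreover have "(- (lam * x)) ^ k = (- lam) ^ k * x ^ k"
      by (simp add: power_mult_distrib[symmetric])
    ultimately show ?thesis
      using real_power_of_nat[OF assms, of "n + k"] by (simp add: fpp_coeff_def power_add divide_inverse mult_ac)
  qed
  then have "(\<lambda>k. fpp_coeff 1 lam n k * real_power x (1 * real (n + k))) sums (x ^ n * exp (- (lam * x)))"
    by (simp only: sums_mult exp_converges)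
  then have "fpp_series 1 lam n x = x ^ n * exp (- (lam * x))"
    unfolding fpp_series_def by (rule sums_unique[symmetric])
  then show ?thesis by (simp add: power_mult_distrib)
qed

section \<open>The fractional Poisson process\<close>

context prob_space
begin

lemma indep_var_sym:
  assumes "indep_var S X T Y" shows "indep_var T Y S X"
proof -
  have "indep_set B A" if "indep_set A B" for A B
    using that unfolding indep_sets2_eq by (metis Int_commute mult.commute)
  with assms show ?thesis unfolding indep_var_eq by blast
qed

lemma indep_processes_sym:
  assumes "indep_processes M X Y" shows "indep_processes M Y X"
  using assms unfolding indep_processes_def by (rule indep_var_sym)

lemma indep_processes_measurable:
  assumes "indep_processes M X Y" "0 \<le> t"
  shows "X t \<in> borel_measurable M"
proof -
  have "(\<lambda>\<omega>. \<lambda>t\<in>{0..}. X t \<omega>) \<in> measurable M (PiM {0..} (\<lambda>_. borel))"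
    using assms(1) by (simp add: indep_processes_def indep_var_distribution_eq)
  then have "(\<lambda>\<omega>. (\<lambda>t\<in>{0..}. X t \<omega>) t) \<in> borel_measurable M"
    by (rule measurable_compose[OF _ measurable_component_singleton]) (use \<open>0 \<le> t\<close> in simp)
  then show ?thesis using \<open>0 \<le> t\<close> by simp
qed

lemma nat_valued_event:
  fixes Y :: "'a \<Rightarrow> nat"
  assumes [measurable]: "(\<lambda>\<omega>. real (Y \<omega>)) \<in> borel_measurable M"
  shows "{\<omega> \<in> space M. Y \<omega> = n} \<in> events"
proof -
  have "{\<omega> \<in> space M. real (Y \<omega>) = real n} \<in> events" by measurable
  then show ?thesis by simp
qed

lemma poisson_process_pmf:
  assumes "poisson_process M lam N" "0 \<le> r" "0 < lam"
  shows "prob {\<omega> \<in> space M. N r \<omega> = n} = (lam * r) ^ n / fact n * exp (- (lam * r))"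
proof (cases "r = 0")
  \<comment> \<open>The law of \<open>N r\<close> is prescribed only for positive \<open>r\<close>;
    at 0 the process vanishes almost surely, which agrees with the formula since
    \<open>0 ^ 0 = 1\<close>.\<close>
  case True
  have "AE \<omega> in M. real (N 0 \<omega>) = 0" and [measurable]: "(\<lambda>\<omega>. real (N 0 \<omega>)) \<in> borel_measurable M"
    using assms by (auto simp: poisson_process_def levy_process_def)
  then have "prob {\<omega> \<in> space M. N 0 \<omega> = n} = prob {\<omega> \<in> space M. 0 = n}"
    by (intro finite_measure_eq_AE nat_valued_event) (auto elim: eventually_mono)
  then show ?thesis using True by (cases "n = 0") (auto simp: prob_space)
next
  case False
  with assms have r: "0 < r" by simp
  then have [measurable]: "N r \<in> measurable M (count_space UNIV)"
    and distr: "distr M (count_space UNIV) (N r) = measure_pmf (poisson_pmf (lam * r))"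
    using assms by (auto simp: poisson_process_def)
  have "prob {\<omega> \<in> space M. N r \<omega> = n} = measure (distr M (count_space UNIV) (N r)) {n}"
    by (auto simp: measure_distr intro!: arg_cong[where f = prob])
  also have "\<dots> = pmf (poisson_pmf (lam * r)) n"
    unfolding distr by (simp add: pmf.rep_eq)
  finally show ?thesis using r \<open>0 < lam\<close> by simp
qed

lemma poisson_process_right_continuous:
  assumes "poisson_process M lam N"
  shows "AE \<omega> in M. \<forall>t\<ge>0. ((\<lambda>s. real (N s \<omega>)) \<longlongrightarrow> real (N t \<omega>)) (at_right t)"
proof -
  have "AE \<omega> in M. cadlag (\<lambda>t. real (N t \<omega>))"
    using assms by (simp add: poisson_process_def levy_process_def)
  then show ?thesis by eventually_elim (simp add: cadlag_def)
qed

lemma inverse_stable_exp_moment: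
  assumes sub: "subordinator M (\<lambda>s. s powr \<beta>) D" and "0 < \<beta>" "0 \<le> a"
    and "inverse_subordinator D r \<in> borel_measurable M"
  shows "integrable M (\<lambda>\<omega>. exp (a * inverse_subordinator D r \<omega>))"
proof (rule exp_moment_inverse_subordinator[OF sub])
  show "0 < (a + 1) powr (1 / \<beta>)" using \<open>0 \<le> a\<close> by simp
  show "a + 1 \<le> ((a + 1) powr (1 / \<beta>)) powr \<beta>"
    using \<open>0 \<le> a\<close> \<open>0 < \<beta>\<close> by (simp add: powr_powr)
qed fact+

text \<open>The inverse subordinator is right continuous and nondecreasing, so it approaches its
  limit from the right, where the Poisson path is right continuous.\<close>

lemma fpp_right_continuous:
  assumes "fractional_poisson_process M \<beta> lam N\<beta>"
  shows "AE \<omega> in M. \<forall>t\<ge>0. ((\<lambda>s. real (N\<beta> s \<omega>)) \<longlongrightarrow> real (N\<beta> t \<omega>)) (at_right t)"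
proof (cases "\<beta> = 1")
  case True
  with assms show ?thesis
    by (auto simp: fractional_poisson_process_def intro: poisson_process_right_continuous)
next
  case False
  with assms obtain N D where N: "poisson_process M lam N" and D: "subordinator M (\<lambda>s. s powr \<beta>) D"
    and N\<beta>: "\<forall>t\<ge>0. \<forall>\<omega>\<in>space M. N\<beta> t \<omega> = N (inverse_subordinator D t \<omega>) \<omega>"
    by (auto simp: fractional_poisson_process_def)
  have "AE \<omega> in M. \<forall>T. \<exists>r\<ge>0. T < D r \<omega>"
    by (rule subordinator_unbounded[OF D zero_less_one]) simp
  with AE_space poisson_process_right_continuous[OF N] show ?thesis
  proof eventually_elim
    case (elim \<omega>)
    let ?E = "\<lambda>t. inverse_subordinator D t \<omega>"
    show ?case
    proof (intro allI impI)
      fix t :: real assume "0 \<le> t"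
      have "0 \<le> ?E t" using elim by (intro inverse_subordinator_nonneg) auto
      have "((\<lambda>s. real (N (?E s) \<omega>)) \<longlongrightarrow> real (N (?E t) \<omega>)) (at_right t)"
      \<comment> \<open>The half-line is closed because the inverse may stay constant to the right
        of \<open>t\<close>.\<close>
      proof (rule continuous_within_tendsto_compose[where f = "\<lambda>x. real (N x \<omega>)" and S = "{?E t..}"])
        show "continuous (at (?E t) within {?E t..}) (\<lambda>x. real (N x \<omega>))"
          using elim \<open>0 \<le> ?E t\<close> by (simp add: continuous_within at_within_Ici_at_right)
        show "(?E \<longlongrightarrow> ?E t) (at_right t)"
          using elim by (intro inverse_subordinator_right_continuous) auto
        show "\<forall>\<^sub>F s in at_right t. ?E s \<in> {?E t..}"
          using eventually_at_right_less[of t]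
          by eventually_elim (use elim in \<open>auto intro: inverse_subordinator_mono\<close>)
      qed
      moreover have "\<forall>\<^sub>F s in at_right t. real (N (?E s) \<omega>) = real (N\<beta> s \<omega>)"
        using eventually_at_right_less[of t]
        by eventually_elim (use elim N\<beta> \<open>0 \<le> t\<close> in auto)
      ultimately have "((\<lambda>s. real (N\<beta> s \<omega>)) \<longlongrightarrow> real (N (?E t) \<omega>)) (at_right t)"
        by (rule Lim_transform_eventually)
      then show "((\<lambda>s. real (N\<beta> s \<omega>)) \<longlongrightarrow> real (N\<beta> t \<omega>)) (at_right t)"
        using elim(1) N\<beta> \<open>0 \<le> t\<close> by simp
    qed
  qed
qed

text \<open>The mixture formula gives the expected Poisson weights at the inverse stable
  subordinator. Expanding them in its moments and inserting the moment formula yields a power series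
  in \<open>r powr \<beta>\<close>.\<close>

lemma fpp_pmf:
  assumes fpp: "fractional_poisson_process M \<beta> lam N\<beta>" and "0 < \<beta>" "0 < lam" "0 \<le> r"
    and ev: "{\<omega> \<in> space M. N\<beta> r \<omega> = n} \<in> events"
  shows "prob {\<omega> \<in> space M. N\<beta> r \<omega> = n} = lam ^ n / fact n * fpp_series \<beta> lam n r"
proof (cases "\<beta> = 1")
  case True
  with fpp have "poisson_process M lam N\<beta>"
    by (simp add: fractional_poisson_process_def)
  then show ?thesis
    unfolding True fpp_series_1[OF \<open>0 \<le> r\<close>] using assms by (intro poisson_process_pmf)
next
  case False
  with fpp obtain N D where N: "poisson_process M lam N" and D: "subordinator M (\<lambda>s. s powr \<beta>) D"
    and ind: "indep_processes M (\<lambda>t \<omega>. real (N t \<omega>)) (inverse_subordinator D)"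
    and N\<beta>: "\<forall>t\<ge>0. \<forall>\<omega>\<in>space M. N\<beta> t \<omega> = N (inverse_subordinator D t \<omega>) \<omega>"
    by (auto simp: fractional_poisson_process_def)
  let ?E = "inverse_subordinator D r"
  have ind': "indep_processes M (inverse_subordinator D) (\<lambda>t \<omega>. real (N t \<omega>))"
    using ind by (rule indep_processes_sym)
  have E[measurable]: "?E \<in> borel_measurable M"
    using indep_processes_measurable[OF ind' \<open>0 \<le> r\<close>] .
  have "AE \<omega> in M. \<forall>T. \<exists>r\<ge>0. T < D r \<omega>"
    by (rule subordinator_unbounded[OF D zero_less_one]) simp
  then have nonneg: "AE \<omega> in M. 0 \<le> ?E \<omega>"
    by eventually_elim (auto intro: inverse_subordinator_nonneg)
  have set_eq: "{\<omega> \<in> space M. N (?E \<omega>) \<omega> = n} = {\<omega> \<in> space M. N\<beta> r \<omega> = n}"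
    using N\<beta> \<open>0 \<le> r\<close> by auto
  have "prob {\<omega> \<in> space M. N (?E \<omega>) \<omega> = n} =
      expectation (\<lambda>\<omega>. (lam * ?E \<omega>) ^ n / fact n * exp (- (lam * ?E \<omega>)))"
  proof (rule prob_time_change[OF ind' \<open>0 \<le> r\<close> nonneg poisson_process_right_continuous[OF N]])
    show "{\<omega> \<in> space M. N (?E \<omega>) \<omega> = n} \<in> events"
      unfolding set_eq by (rule ev)
  qed (use poisson_process_pmf[OF N] \<open>0 < lam\<close> in auto)
  also have "\<dots> = expectation (\<lambda>\<omega>. lam ^ n / fact n * fpp_series 1 lam n (?E \<omega>))"
  proof (rule integral_cong_AE)
    show "AE \<omega> in M. (lam * ?E \<omega>) ^ n / fact n * exp (- (lam * ?E \<omega>)) =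
        lam ^ n / fact n * fpp_series 1 lam n (?E \<omega>)"
      using nonneg by eventually_elim (rule fpp_series_1[symmetric])
  qed measurable
  also have "\<dots> = lam ^ n / fact n * expectation (\<lambda>\<omega>. fpp_series 1 lam n (?E \<omega>))"
    by simp
  also have "expectation (\<lambda>\<omega>. fpp_series 1 lam n (?E \<omega>)) =
      (\<Sum>k. fpp_coeff 1 lam n k * expectation (\<lambda>\<omega>. real_power (?E \<omega>) (1 * real (n + k))))"
    using inverse_stable_exp_moment[OF D \<open>0 < \<beta>\<close> _ E] \<open>0 < lam\<close> nonneg
    by (intro sums_unique fpp_series_sums_expectation) auto
  also have "\<dots> = fpp_series \<beta> lam n r"
    unfolding fpp_series_def
  proof (rule suminf_cong)
    fix k
    have "expectation (\<lambda>\<omega>. real_power (?E \<omega>) (1 * real (n + k))) = expectation (\<lambda>\<omega>. ?E \<omega> ^ (n + k))"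
    proof (rule integral_cong_AE)
      show "AE \<omega> in M. real_power (?E \<omega>) (1 * real (n + k)) = ?E \<omega> ^ (n + k)"
        using nonneg by eventually_elim (simp only: real_power_of_nat mult_1)
    qed measurable
    also have "\<dots> = fact (n + k) / Gamma (\<beta> * real (n + k) + 1) * real_power r (\<beta> * real (n + k))"
      by (rule inverse_stable_subordinator_moment[OF D \<open>0 < \<beta>\<close> \<open>0 \<le> r\<close> E])
    finally have E_moment: "expectation (\<lambda>\<omega>. real_power (?E \<omega>) (1 * real (n + k))) =
      fact (n + k) / Gamma (\<beta> * real (n + k) + 1) * real_power r (\<beta> * real (n + k))" .
    \<comment> \<open>The factorial in the moment cancels this Gamma value, which turns the
      coefficient for exponent 1 into the one for \<open>\<beta>\<close>.\<close>
    have "Gamma (1 * real (k + n) + 1) = fact (n + k)"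
      using Gamma_fact[of "n + k", where 'a = real] by (simp add: add_ac)
    then show "fpp_coeff 1 lam n k * expectation (\<lambda>\<omega>. real_power (?E \<omega>) (1 * real (n + k))) =
        fpp_coeff \<beta> lam n k * real_power r (\<beta> * real (n + k))"
      unfolding E_moment fpp_coeff_def by (simp add: add.commute)
  qed
  finally show ?thesis unfolding set_eq .
qed

end

text \<open>Integrability and summability are part of the conclusion because the Bochner integral
  and the infinite sum are total functions: without them the formula could refer to default
  values.\<close>

theorem mainTheorem6:
  fixes M :: "'a measure" and D :: "real \<Rightarrow> 'a \<Rightarrow> real" and N\<beta> :: "real \<Rightarrow> 'a \<Rightarrow> nat"
    and \<nu> :: "real measure" and b \<beta> lam t :: real and n :: nat
  assumes "prob_space M"
    and "0 < \<beta>" "\<beta> \<le> 1" and "0 < lam"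
    and "0 \<le> b" and "levy_measure \<nu>" and "emeasure \<nu> {0<..} = \<infinity>"
    and "subordinator M (bernstein b \<nu>) D"
    and "fractional_poisson_process M \<beta> lam N\<beta>"
    and "indep_processes M (inverse_subordinator D) (\<lambda>t \<omega>. real (N\<beta> t \<omega>))"
    and "\<And>t. 0 \<le> t \<Longrightarrow> time_changed_fpp N\<beta> D t \<in> measurable M (count_space UNIV)"
    and "0 \<le> t"
  shows "(\<forall>k. integrable M (\<lambda>\<omega>. real_power (inverse_subordinator D t \<omega>) (\<beta> * real (n + k)))) \<and>
    summable (\<lambda>k. fact (n + k) / fact k * ((- lam) ^ k / Gamma (\<beta> * real (k + n) + 1)) *
      (\<integral>\<omega>. real_power (inverse_subordinator D t \<omega>) (\<beta> * real (n + k)) \<partial>M)) \<and>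
    measure M {\<omega> \<in> space M. time_changed_fpp N\<beta> D t \<omega> = n} =
      lam ^ n / fact n *
      (\<Sum>k. fact (n + k) / fact k * ((- lam) ^ k / Gamma (\<beta> * real (k + n) + 1)) *
        (\<integral>\<omega>. real_power (inverse_subordinator D t \<omega>) (\<beta> * real (n + k)) \<partial>M))"
proof -
  interpret prob_space M by fact
  let ?E = "inverse_subordinator D t"
  have ind': "indep_processes M (\<lambda>t \<omega>. real (N\<beta> t \<omega>)) (inverse_subordinator D)"
    using assms(10) by (rule indep_processes_sym)
  have E[measurable]: "?E \<in> borel_measurable M"
    using indep_processes_measurable[OF assms(10) \<open>0 \<le> t\<close>] .
  \<comment> \<open>Every rate \<open>a\<close> is admissible because the Bernstein function is
    unbounded.\<close>
  have exp: "integrable M (\<lambda>\<omega>. exp (a * ?E \<omega>))" if "0 \<le> a" for a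
  proof -
    obtain s where "0 < s" "a + 1 \<le> bernstein b \<nu> s"
      using bernstein_unbounded assms by blast
    then show ?thesis
      using exp_moment_inverse_subordinator[OF assms(8) _ _ that E] by blast
  qed
  obtain s where "0 < s" "1 \<le> bernstein b \<nu> s"
    using bernstein_unbounded assms by blast
  then have "AE \<omega> in M. \<forall>T. \<exists>r\<ge>0. T < D r \<omega>"
    by (intro subordinator_unbounded[OF assms(8)]) auto
  then have nonneg: "AE \<omega> in M. 0 \<le> ?E \<omega>"
    by eventually_elim (auto intro: inverse_subordinator_nonneg)
  have sums: "(\<lambda>k. fpp_coeff \<beta> lam n k * expectation (\<lambda>\<omega>. real_power (?E \<omega>) (\<beta> * real (n + k)))) sums
      expectation (\<lambda>\<omega>. fpp_series \<beta> lam n (?E \<omega>))"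
    using exp assms by (intro fpp_series_sums_expectation E nonneg)
  have "prob {\<omega> \<in> space M. N\<beta> (?E \<omega>) \<omega> = n} = expectation (\<lambda>\<omega>. lam ^ n / fact n * fpp_series \<beta> lam n (?E \<omega>))"
  proof (rule prob_time_change[OF assms(10) \<open>0 \<le> t\<close> nonneg fpp_right_continuous[OF assms(9)]])
    show "{\<omega> \<in> space M. N\<beta> (?E \<omega>) \<omega> = n} \<in> events"
      using measurable_sets[OF assms(11)[OF \<open>0 \<le> t\<close>], of "{n}"]
      by (simp add: time_changed_fpp_def vimage_def Int_def conj_commute)
    show "prob {\<omega> \<in> space M. N\<beta> r \<omega> = n} = lam ^ n / fact n * fpp_series \<beta> lam n r" if "0 \<le> r" for r
      using assms(2,4,9) that nat_valued_event[OF indep_processes_measurable[OF ind' that]]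
      by (intro fpp_pmf)
  qed measurable
  also have "\<dots> = lam ^ n / fact n *
      (\<Sum>k. fpp_coeff \<beta> lam n k * expectation (\<lambda>\<omega>. real_power (?E \<omega>) (\<beta> * real (n + k))))"
    using sums_unique[OF sums] by simp
  finally have main: "prob {\<omega> \<in> space M. time_changed_fpp N\<beta> D t \<omega> = n} = lam ^ n / fact n *
      (\<Sum>k. fpp_coeff \<beta> lam n k * expectation (\<lambda>\<omega>. real_power (?E \<omega>) (\<beta> * real (n + k))))"
    unfolding time_changed_fpp_def .
  show ?thesis
  proof (intro conjI allI)
    show "integrable M (\<lambda>\<omega>. real_power (?E \<omega>) (\<beta> * real (n + k)))" for k
      using exp assms by (intro integrable_real_power E nonneg)
  qed (use sums_summable[OF sums] main in \<open>simp_all only: fpp_coeff_def\<close>)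
qed

end
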